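(* Let $r\ge 0$ and $k$ be integers with $0\le k\le r$. Consider pairs of families $\mathcal{A}\subset\mathbb{N}^{(r)}$, $\mathcal{B}\subset\mathbb{N}^{(r-1)}$ such that every $A\in\mathcal{A}$ contains at least $k$ distinct members of $\mathcal{B}$ as subsets, and write $a=|\mathcal{A}|$, $b=|\mathcal{B}|$. Then: (i) If $k=0$, the minimum possible value of $b$ is $0$, for every value of $a$. (ii) If $k=1$, the minimum possible value of $b$ is $1$ if $a\ge 1$, and $0$ if $a=0$. (iii) If $k=2$, then $f(r,2,b)=\binom{b}{2}$ for every integer $b\ge 0$. (iv) If $k=3$, then for all integers $c_2>c_1\ge 0$ with $c_2\ge 29$, \[f\left(r,3,\binom{c_2}{2}+\binom{c_1}{1}\right)=\binom{c_2}{3}+\binom{c_1}{2}.\]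
   Context: $\mathbb{N}^{(s)}$ denotes the family of all $s$-element subsets of $\mathbb{N}$. For integers $0\le k\le r$ and $b\ge 0$, $f(r,k,b)$ denotes the maximum of $|\mathcal{A}|$ over all pairs of families $\mathcal{A}\subset\mathbb{N}^{(r)}$, $\mathcal{B}\subset\mathbb{N}^{(r-1)}$ with $|\mathcal{B}|=b$ such that for every $A\in\mathcal{A}$ there exist $k$ distinct sets $B_1,\dots,B_k\in\mathcal{B}$ with $B_i\subset A$ for all $i$. Binomial coefficients $\binom{c}{i}$ with $c<i$ are $0$. *)

theory Defs
  imports Main
begin

text \<open>The layer N^(s) of all s-element subsets of the naturals; s is an integer so that
  N^(r-1) is empty when r = 0.\<close>
definition layer :: "int \<Rightarrow> nat set set" where
  "layer s = {X. finite X \<and> int (card X) = s}"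

definition admissible :: "nat \<Rightarrow> nat \<Rightarrow> nat set set \<Rightarrow> nat set set \<Rightarrow> bool" where
  "admissible r k A B \<longleftrightarrow> A \<subseteq> layer (int r) \<and> B \<subseteq> layer (int r - 1) \<and>
     finite A \<and> finite B \<and> (\<forall>X\<in>A. k \<le> card {Y\<in>B. Y \<subseteq> X})"

definition f :: "nat \<Rightarrow> nat \<Rightarrow> nat \<Rightarrow> nat" where
  "f r k b = (GREATEST a. \<exists>A B. admissible r k A B \<and> card A = a \<and> card B = b)"

definition min_b :: "nat \<Rightarrow> nat \<Rightarrow> nat \<Rightarrow> nat" where
  "min_b r k a = (LEAST b. \<exists>A B. admissible r k A B \<and> card A = a \<and> card B = b)"

end

theory Submission
  imports Defs
begin

text \<open>
  Call the members of a family \<open>B\<close> of \<open>q\<close>-sets points, and call a \<open>(q + 1)\<close>-set that contains at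
  least three points a line. Two points lie on at most one line, namely their union, which settles
  the case \<open>k = 2\<close>. For \<open>k = 3\<close> write \<open>h(C(c,2) + c1) = C(c,3) + C(c1,2)\<close>; the number of lines is
  bounded by induction on the number \<open>b\<close> of points. Splitting by an element \<open>x\<close> gives
  \<open>|lines B| = |lines (del B x)| + |lines (link B x)| + |mixed B x|\<close>, where each mixed set is a
  point avoiding \<open>x\<close>. Let \<open>d\<close> be the number of points containing \<open>x\<close>.

  If some \<open>x\<close> has \<open>0 < d < c\<close>, the last two terms are at most \<open>C(d,2)\<close> and \<open>h(b - d) + C(d,2) \<le> h(b)\<close>.
  Otherwise all degrees are at least \<open>c\<close>. Graphs (\<open>q = 2\<close>) are then impossible, and for \<open>q \<ge> 3\<close> every
  line comes from a line of at least \<open>q - 2\<close> of its links, so averaging produces an \<open>x\<close>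
  whose link has at least \<open>d |lines B| / (3 b)\<close> lines. This forces \<open>d\<close> to be so large that
  \<open>h(d) + h(b - d) + (b - d) \<le> h(b)\<close>, except when \<open>d = C(c,2)\<close> and \<open>c1 \<le> 3\<close>.

  The induction has to start at \<open>b = 0\<close>, where these estimates are not quite sufficient. For a few
  small values of \<open>b\<close> only \<open>h(b) + 1\<close> or \<open>h(b) + 2\<close> is proved. Such an excess dies out: it
  survives a step with \<open>d = c - 1\<close> undiminished only if \<open>B\<close> contains a copy of the edge set of a complete
  graph on \<open>c\<close> vertices, in which every pair of points on a common \<open>(q + 1)\<close>-set already spans a
  line; every further line then needs two of the remaining \<open>c1\<close> points, so there are at most \<open>h(b)\<close>.
  The exception \<open>d = C(c,2)\<close> is treated in the same way.
\<close>

section \<open>Points, lines, links\<close>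

definition uniform :: "nat \<Rightarrow> 'a set set \<Rightarrow> bool" where
  "uniform q B \<longleftrightarrow> finite B \<and> (\<forall>Y\<in>B. finite Y \<and> card Y = q)"

text \<open>The points inside a (q + 1)-set are indexed by the single element that they omit. A spot
  already forces \<open>X\<close> to be finite with \<open>q + 1\<close> elements
  (\<open>spot_finite_card\<close>), so \<open>X\<close> may range over all sets.\<close>

definition spots :: "'a set set \<Rightarrow> 'a set \<Rightarrow> 'a set" where
  "spots B X = {x\<in>X. X - {x} \<in> B}"

definition lines :: "'a set set \<Rightarrow> 'a set set" where
  "lines B = {X. 3 \<le> card (spots B X)}"

text \<open>Modelled on the edge set of a complete graph, where two edges sharing a vertex always
  belong to a triangle.\<close>

definition saturated :: "'a set set \<Rightarrow> bool" where
  "saturated B \<longleftrightarrow> (\<forall>X. card (spots B X) \<noteq> 2)"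

definition del :: "'a set set \<Rightarrow> 'a \<Rightarrow> 'a set set" where
  "del B x = {Y\<in>B. x \<notin> Y}"

definition link :: "'a set set \<Rightarrow> 'a \<Rightarrow> 'a set set" where
  "link B x = {Z. x \<notin> Z \<and> insert x Z \<in> B}"

text \<open>For such \<open>W\<close> the set \<open>insert x W\<close> holds two points through
  \<open>x\<close> and \<open>W\<close> itself as the third, so it is a line that does not come from
  a line of the link.\<close>

definition mixed :: "'a set set \<Rightarrow> 'a \<Rightarrow> 'a set set" where
  "mixed B x = {W \<in> del B x. card (spots (link B x) W) = 2}"

lemma uniform_subset: "uniform q B \<Longrightarrow> M \<subseteq> B \<Longrightarrow> uniform q M"
  unfolding uniform_def by (meson finite_subset subsetD)

lemma spot_finite_card:
  assumes "uniform q B" "x \<in> spots B X"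
  shows "finite X" "card X = Suc q"
proof -
  have "finite (X - {x})" "card (X - {x}) = q" "x \<in> X"
    using assms unfolding uniform_def spots_def by auto
  then show "finite X" by simp
  with \<open>card (X - {x}) = q\<close> \<open>x \<in> X\<close> show "card X = Suc q"
    by (metis card_Suc_Diff1)
qed

lemma finite_spots:
  assumes "uniform q B" shows "finite (spots B X)"
proof (cases "spots B X = {}")
  case False
  then obtain x where "x \<in> spots B X" by blast
  then have "finite X" by (rule spot_finite_card(1)[OF assms])
  then show ?thesis unfolding spots_def by simp
qed simp

lemma spot_of_subset:
  assumes "uniform q B" "Y \<in> B" "Y \<subseteq> X" "finite X" "card X = Suc q"
  obtains y where "y \<in> spots B X" "X - {y} = Y"
proof -
  have "finite Y" "card Y = q" using assms unfolding uniform_def by auto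
  then have "card (X - Y) = 1" using assms by (simp add: card_Diff_subset)
  then obtain y where y: "X - Y = {y}" using card_1_singletonE by blast
  then have "X - {y} = Y" using assms(3) by blast
  then show ?thesis using that[of y] y assms(2) unfolding spots_def by auto
qed

lemma lines_ground:
  assumes "2 \<le> card (spots B X)" shows "X \<subseteq> \<Union>B"
proof -
  obtain y z where yz: "y \<in> spots B X" "z \<in> spots B X" "y \<noteq> z"
    using assms card_le_Suc0_iff_eq[of "spots B X"] card.infinite[of "spots B X"] by force
  then have "X = (X - {y}) \<union> (X - {z})" by auto
  then show ?thesis using yz unfolding spots_def by blast
qed

lemma finite_rich:
  assumes "uniform q B" shows "finite {X. 2 \<le> card (spots B X)}"
proof (rule finite_subset)
  show "{X. 2 \<le> card (spots B X)} \<subseteq> Pow (\<Union>B)" using lines_ground by blast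
  show "finite (Pow (\<Union>B))" using assms unfolding uniform_def by simp
qed

lemma finite_lines:
  assumes "uniform q B" shows "finite (lines B)"
  by (rule finite_subset[OF _ finite_rich[OF assms]]) (auto simp: lines_def)

lemma spots_del: "x \<notin> X \<Longrightarrow> spots (del B x) X = spots B X"
  unfolding spots_def del_def by auto

lemma spots_insert:
  assumes "x \<notin> X"
  shows "spots B (insert x X) = spots (link B x) X \<union> (if X \<in> B then {x} else {})"
proof -
  have "insert x X - {y} = insert x (X - {y})" if "y \<in> X" for y using that assms by auto
  moreover have "insert x X - {x} = X" using assms by auto
  ultimately show ?thesis using assms unfolding spots_def link_def by auto
qed

lemma card_spots_insert:
  assumes "uniform q B" "x \<notin> X"
  shows "card (spots B (insert x X)) = card (spots (link B x) X) + (if X \<in> B then 1 else 0)"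
proof -
  have "x \<notin> spots (link B x) X" using assms(2) unfolding spots_def by auto
  moreover have "finite (spots B (insert x X))" by (rule finite_spots[OF assms(1)])
  ultimately show ?thesis unfolding spots_insert[OF assms(2)] by auto
qed

lemma uniform_del: "uniform q B \<Longrightarrow> uniform q (del B x)"
  unfolding uniform_def del_def by auto

lemma link_image: "insert x ` link B x = {Y\<in>B. x \<in> Y}"
proof -
  have "Y \<in> insert x ` link B x" if "Y \<in> B" "x \<in> Y" for Y
    by (rule image_eqI[of _ _ "Y - {x}"]) (use that in \<open>auto simp: link_def insert_absorb\<close>)
  then show ?thesis unfolding link_def by auto
qed

lemma inj_insert_link: "inj_on (insert x) (link B x)"
  unfolding link_def inj_on_def by (metis Diff_insert_absorb mem_Collect_eq)

lemma uniform_link: assumes "uniform q B" shows "uniform (q - 1) (link B x)"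
proof -
  have "finite (link B x)"
    by (rule finite_imageD[OF _ inj_insert_link]) (use assms in \<open>auto simp: link_image uniform_def\<close>)
  moreover have "finite Z \<and> card Z = q - 1" if "Z \<in> link B x" for Z
    using that assms unfolding link_def uniform_def by fastforce
  ultimately show ?thesis unfolding uniform_def by auto
qed

lemma card_link: "card (link B x) = card {Y\<in>B. x \<in> Y}"
  using card_image[OF inj_insert_link, of x B] by (simp add: link_image)

lemma card_del_link:
  assumes "uniform q B" shows "card B = card (del B x) + card (link B x)"
proof -
  have "B = del B x \<union> {Y\<in>B. x \<in> Y}" "del B x \<inter> {Y\<in>B. x \<in> Y} = {}"
    unfolding del_def by auto
  moreover have "finite B" using assms unfolding uniform_def by simp
  ultimately show ?thesis unfolding card_link by (metis card_Un_disjoint finite_Un)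
qed

lemma rich_link_avoids:
  assumes "uniform q B" "2 \<le> card (spots (link B x) W)" shows "x \<notin> W"
  using lines_ground[OF assms(2)] unfolding link_def by auto

text \<open>A line avoiding \<open>x\<close> is a line of the deletion. A line through
  \<open>x\<close> loses only the point \<open>X - {x}\<close> on passing to the link, so it keeps
  three points there, or exactly two with \<open>X - {x}\<close> itself in \<open>B\<close>.\<close>

lemma card_lines_split:
  assumes u: "uniform q B"
  shows "card (lines B) = card (lines (del B x)) + card (lines (link B x)) + card (mixed B x)"
proof -
  let ?I = "lines (link B x) \<union> mixed B x"
  have ul: "uniform (q - 1) (link B x)" and ud: "uniform q (del B x)"
    using uniform_link[OF u] uniform_del[OF u] by auto
  have avoid: "x \<notin> W" if "W \<in> ?I" for W
    using that rich_link_avoids[OF u, of x W] unfolding lines_def mixed_def by auto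
  have avoid': "x \<notin> X" if "X \<in> lines (del B x)" for X
    using that lines_ground[of "del B x" X] unfolding lines_def del_def by fastforce
  have eq: "lines B = lines (del B x) \<union> insert x ` ?I"
  proof (intro equalityI subsetI)
    fix X assume X: "X \<in> lines B"
    show "X \<in> lines (del B x) \<union> insert x ` ?I"
    proof (cases "x \<in> X")
      case False
      then show ?thesis using X spots_del[OF False] unfolding lines_def by auto
    next
      case True
      then have eqX: "insert x (X - {x}) = X" and nx: "x \<notin> X - {x}" by auto
      have "3 \<le> card (spots (link B x) (X - {x})) + (if X - {x} \<in> B then 1 else 0)"
        using X card_spots_insert[OF u nx] unfolding lines_def eqX by simp
      then have "X - {x} \<in> ?I" unfolding lines_def mixed_def del_def by (auto split: if_splits)
      then show ?thesis using eqX by (metis UnI2 imageI)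
    qed
  next
    fix X assume "X \<in> lines (del B x) \<union> insert x ` ?I"
    then show "X \<in> lines B"
    proof
      assume X: "X \<in> lines (del B x)"
      then show ?thesis using spots_del[OF avoid'[OF X]] unfolding lines_def by simp
    next
      assume "X \<in> insert x ` ?I"
      then obtain W where W: "W \<in> ?I" "X = insert x W" by blast
      then show ?thesis using card_spots_insert[OF u avoid[OF W(1)]]
        unfolding lines_def mixed_def del_def by auto
    qed
  qed
  have fin: "finite (lines (link B x))" "finite (mixed B x)" "finite (lines (del B x))"
    using finite_lines[OF ul] finite_lines[OF ud] ud unfolding mixed_def uniform_def by auto
  have "inj_on (insert x) ?I" using avoid unfolding inj_on_def by (metis Diff_insert_absorb)
  then have "card (insert x ` ?I) = card ?I" by (rule card_image)
  also have "\<dots> = card (lines (link B x)) + card (mixed B x)"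
    by (rule card_Un_disjoint) (use fin in \<open>auto simp: lines_def mixed_def\<close>)
  finally have ci: "card (insert x ` ?I) = card (lines (link B x)) + card (mixed B x)" .
  have "card (lines B) = card (lines (del B x)) + card (insert x ` ?I)"
    unfolding eq by (rule card_Un_disjoint) (use fin avoid' in auto)
  then show ?thesis using ci by simp
qed

lemma card_mixed_le:
  assumes "uniform q B" shows "card (mixed B x) \<le> card (del B x)"
  by (rule card_mono) (use uniform_del[OF assms, of x] in \<open>auto simp: uniform_def mixed_def\<close>)

section \<open>Counting ordered pairs of points at distance one and two\<close>

definition near :: "'a set set \<Rightarrow> ('a set \<times> 'a set) set" where
  "near B = {(P, Q). P \<in> B \<and> Q \<in> B \<and> card (P - Q) = 1}"

definition far :: "'a set set \<Rightarrow> ('a set \<times> 'a set) set" where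
  "far B = {(P, Q). P \<in> B \<and> Q \<in> B \<and> card (P - Q) = 2}"

lemma finite_near_far: assumes "uniform q B" shows "finite (near B)" "finite (far B)"
proof -
  have "finite (B \<times> B)" using assms unfolding uniform_def by simp
  then show "finite (near B)" "finite (far B)"
    by (auto intro: finite_subset[of _ "B \<times> B"] simp: near_def far_def)
qed

lemma card_off_diagonal:
  assumes "finite S" shows "card {(y, z). y \<in> S \<and> z \<in> S \<and> y \<noteq> z} = card S * (card S - 1)"
proof -
  have "{(y, z). y \<in> S \<and> z \<in> S \<and> y \<noteq> z} = (SIGMA y:S. S - {y})" by auto
  then show ?thesis using assms by simp
qed

lemma card_near_far:
  assumes "uniform q B" shows "card (near B) + card (far B) \<le> card B * (card B - 1)"
proof -
  have fB: "finite B" using assms unfolding uniform_def by simp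
  have "card (near B) + card (far B) = card (near B \<union> far B)"
    by (rule card_Un_disjoint[symmetric]) (use finite_near_far[OF assms] in \<open>auto simp: near_def far_def\<close>)
  also have "\<dots> \<le> card {(P, Q). P \<in> B \<and> Q \<in> B \<and> P \<noteq> Q}"
  proof (rule card_mono)
    show "finite {(P, Q). P \<in> B \<and> Q \<in> B \<and> P \<noteq> Q}"
      by (rule finite_subset[of _ "B \<times> B"]) (use fB in auto)
  qed (auto simp: near_def far_def)
  finally show ?thesis using card_off_diagonal[OF fB] by simp
qed

text \<open>Two points of \<open>X\<close> that omit different elements have union \<open>X\<close>,
  so the pair determines \<open>X\<close> and both omitted elements.\<close>

lemma inj_pairs_on_rich: "inj_on (\<lambda>(X, y, z). (X - {y}, X - {z})) (SIGMA X:S. {(y, z). y \<in> spots B X \<and> z \<in> spots B X \<and> y \<noteq> z})"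
proof (rule inj_onI, clarsimp)
  fix X y z X' y' z'
  assume h: "y \<in> spots B X" "z \<in> spots B X" "y \<noteq> z" "y' \<in> spots B X'" "z' \<in> spots B X'" "y' \<noteq> z'"
    and e: "X - {y} = X' - {y'}" "X - {z} = X' - {z'}"
  have "X = (X - {y}) \<union> (X - {z})" "X' = (X' - {y'}) \<union> (X' - {z'})" using h by auto
  then have X: "X = X'" using e by simp
  moreover have "y \<in> X" "z \<in> X" "y' \<in> X'" "z' \<in> X'" using h unfolding spots_def by auto
  ultimately show "X = X' \<and> y = y' \<and> z = z'" using e by blast
qed

lemma pairs_on_rich_near:
  "(\<lambda>(X, y, z). (X - {y}, X - {z})) ` (SIGMA X:S. {(y, z). y \<in> spots B X \<and> z \<in> spots B X \<and> y \<noteq> z}) \<subseteq> near B"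
proof clarify
  fix X y z assume h: "y \<in> spots B X" "z \<in> spots B X" "y \<noteq> z"
  then have "(X - {y}) - (X - {z}) = {z}" unfolding spots_def by auto
  then show "(X - {y}, X - {z}) \<in> near B" using h unfolding near_def spots_def by auto
qed

lemma card_pairs_on_rich:
  assumes u: "uniform q B" and S: "finite S"
  shows "card (SIGMA X:S. {(y, z). y \<in> spots B X \<and> z \<in> spots B X \<and> y \<noteq> z})
    = (\<Sum>X\<in>S. card (spots B X) * (card (spots B X) - 1))"
proof -
  have "finite {(y, z). y \<in> spots B X \<and> z \<in> spots B X \<and> y \<noteq> z}" for X
    by (rule finite_subset[of _ "spots B X \<times> spots B X"]) (use finite_spots[OF u] in auto)
  then show ?thesis using S by (simp add: card_off_diagonal[OF finite_spots[OF u]])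
qed

text \<open>Each line contributes at least \<open>3 * 2\<close> ordered near pairs and each member
  of \<open>V\<close> exactly two; by \<open>inj_pairs_on_rich\<close> no pair is counted
  twice.\<close>

lemma card_near_ge:
  assumes u: "uniform q B" and V: "finite V" "\<And>W. W \<in> V \<Longrightarrow> card (spots B W) = 2"
  shows "6 * card (lines B) + 2 * card V \<le> card (near B)"
proof -
  let ?f = "\<lambda>X. card (spots B X) * (card (spots B X) - 1)"
  have fl: "finite (lines B)" by (rule finite_lines[OF u])
  have 1: "6 * card (lines B) \<le> (\<Sum>X\<in>lines B. ?f X)"
  proof -
    have "6 \<le> ?f X" if "X \<in> lines B" for X
    proof -
      have "3 \<le> card (spots B X)" using that unfolding lines_def by simp
      then have "3 * 2 \<le> ?f X" by (intro mult_le_mono) auto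
      then show ?thesis by simp
    qed
    then have "(\<Sum>X\<in>lines B. 6) \<le> (\<Sum>X\<in>lines B. ?f X)" by (intro sum_mono)
    then show ?thesis by simp
  qed
  have 2: "(\<Sum>X\<in>V. ?f X) = 2 * card V" using V by simp
  have disj: "lines B \<inter> V = {}" using V unfolding lines_def by fastforce
  have "6 * card (lines B) + 2 * card V \<le> (\<Sum>X\<in>lines B \<union> V. ?f X)"
    using 1 2 sum.union_disjoint[OF fl V(1) disj, of ?f] by simp
  also have "\<dots> = card ((\<lambda>(X, y, z). (X - {y}, X - {z})) ` (SIGMA X:lines B \<union> V. {(y, z). y \<in> spots B X \<and> z \<in> spots B X \<and> y \<noteq> z}))"
    using card_pairs_on_rich[OF u] fl V(1) by (simp add: card_image[OF inj_pairs_on_rich])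
  also have "\<dots> \<le> card (near B)" by (rule card_mono[OF finite_near_far(1)[OF u] pairs_on_rich_near])
  finally show ?thesis .
qed

lemma card_points:
  assumes u: "uniform q B" and X: "finite X" "card X = Suc q"
  shows "card {Y\<in>B. Y \<subseteq> X} = card (spots B X)"
proof -
  have "bij_betw (\<lambda>y. X - {y}) (spots B X) {Y\<in>B. Y \<subseteq> X}"
    unfolding bij_betw_def
  proof
    show "inj_on (\<lambda>y. X - {y}) (spots B X)" unfolding inj_on_def spots_def by blast
    show "(\<lambda>y. X - {y}) ` spots B X = {Y\<in>B. Y \<subseteq> X}"
    proof (intro equalityI subsetI)
      fix Y assume "Y \<in> {Y\<in>B. Y \<subseteq> X}"
      then show "Y \<in> (\<lambda>y. X - {y}) ` spots B X" using spot_of_subset[OF u _ _ X, of Y] by blast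
    qed (auto simp: spots_def)
  qed
  then show ?thesis by (simp add: bij_betw_same_card)
qed

lemma card_rich_le:
  assumes u: "uniform q B" and S: "finite S" "\<And>X. X \<in> S \<Longrightarrow> 2 \<le> card (spots B X)"
  shows "2 * card S \<le> card B * (card B - 1)"
proof -
  let ?f = "\<lambda>X. card (spots B X) * (card (spots B X) - 1)"
  have "2 \<le> ?f X" if "X \<in> S" for X
  proof -
    have "2 * 1 \<le> ?f X" using S(2)[OF that] by (intro mult_le_mono) auto
    then show ?thesis by simp
  qed
  then have "(\<Sum>X\<in>S. 2) \<le> (\<Sum>X\<in>S. ?f X)" by (intro sum_mono)
  also have "\<dots> = card ((\<lambda>(X, y, z). (X - {y}, X - {z})) ` (SIGMA X:S. {(y, z). y \<in> spots B X \<and> z \<in> spots B X \<and> y \<noteq> z}))"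
    using card_pairs_on_rich[OF u S(1)] by (simp add: card_image[OF inj_pairs_on_rich])
  also have "\<dots> \<le> card (near B)" by (rule card_mono[OF finite_near_far(1)[OF u] pairs_on_rich_near])
  finally show ?thesis using card_near_far[OF u] by simp
qed

text \<open>A line that is not a line of \<open>M\<close> holds fewer than three points of
  \<open>M\<close>, and not two by saturation, so at least two of its points lie in
  \<open>B - M\<close>.\<close>

lemma card_lines_saturated_part:
  assumes u: "uniform q B" and M: "M \<subseteq> B" "saturated M"
  shows "2 * card (lines B) \<le> 2 * card (lines M) + card (B - M) * (card (B - M) - 1)"
proof -
  have uM: "uniform q M" and uE: "uniform q (B - M)" using uniform_subset[OF u] M(1) by auto
  have "2 \<le> card (spots (B - M) X)" if "X \<in> lines B - lines M" for X
  proof -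
    have "spots B X = spots M X \<union> spots (B - M) X" using M(1) unfolding spots_def by auto
    then have "card (spots B X) \<le> card (spots M X) + card (spots (B - M) X)"
      by (metis card_Un_le)
    moreover have "3 \<le> card (spots B X)" "card (spots M X) < 3" "card (spots M X) \<noteq> 2"
      using that M(2) unfolding lines_def saturated_def by auto
    ultimately show ?thesis by linarith
  qed
  then have "2 * card (lines B - lines M) \<le> card (B - M) * (card (B - M) - 1)"
    using card_rich_le[OF uE] finite_lines[OF u] by blast
  moreover have "card (lines B) \<le> card (lines M) + card (lines B - lines M)"
  proof -
    have "card (lines B) \<le> card (lines M \<union> (lines B - lines M))"
      by (rule card_mono) (use finite_lines[OF u] finite_lines[OF uM] in auto)
    also have "\<dots> \<le> card (lines M) + card (lines B - lines M)" by (rule card_Un_le)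
    finally show ?thesis .
  qed
  ultimately show ?thesis by linarith
qed

lemma finite_through:
  assumes "uniform q B" shows "finite {z. z \<notin> Y \<and> insert z Y \<in> lines B}"
proof (rule finite_subset)
  show "{z. z \<notin> Y \<and> insert z Y \<in> lines B} \<subseteq> \<Union>B"
  proof
    fix z assume "z \<in> {z. z \<notin> Y \<and> insert z Y \<in> lines B}"
    then have "insert z Y \<subseteq> \<Union>B" by (intro lines_ground) (simp add: lines_def)
    then show "z \<in> \<Union>B" by simp
  qed
  show "finite (\<Union>B)" using assms unfolding uniform_def by auto
qed

text \<open>Two lines \<open>Y \<union> {z}\<close>, \<open>Y \<union> {z'}\<close> through a point \<open>Y\<close> produce two ordered pairs of points at distance two,
  and a pair \<open>(P, Q)\<close> at distance two has only four common neighbours \<open>Y\<close>, one for each choice of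
  \<open>z \<in> P - Q\<close> and \<open>z' \<in> Q - P\<close>.\<close>

lemma card_far_ge:
  assumes u: "uniform q B"
  defines "K \<equiv> \<lambda>Y. {z. z \<notin> Y \<and> insert z Y \<in> lines B}"
  shows "(\<Sum>Y\<in>B. card (K Y) * (card (K Y) - 1)) \<le> 2 * card (far B)"
proof -
  define S where "S Y z = spots B (insert z Y) - {z}" for Y z
  define T where "T Y = (\<lambda>(z, z'). {(y, y'). y \<in> S Y z \<and> y' \<in> S Y z' \<and> y \<noteq> y'})" for Y
  define Off where "Off Y = {(z, z'). z \<in> K Y \<and> z' \<in> K Y \<and> z \<noteq> z'}" for Y
  define R where "R = (SIGMA Y:B. SIGMA p:Off Y. T Y p)"
  define F where "F = (SIGMA w:far B. (fst w - snd w) \<times> (snd w - fst w))"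
  define g where "g = (\<lambda>(Y, (z, z'), (y, y')). ((insert z Y - {y}, insert z' Y - {y'}), (z :: 'a, z' :: 'a)))"
  have fB: "finite B" and fm: "\<And>Y. Y \<in> B \<Longrightarrow> finite Y \<and> card Y = q"
    using u unfolding uniform_def by auto
  have fK: "finite (K Y)" for Y unfolding K_def by (rule finite_through[OF u])
  have fS: "finite (S Y z)" for Y z unfolding S_def using finite_spots[OF u] by simp
  have fO: "finite (Off Y)" for Y
    by (rule finite_subset[of _ "K Y \<times> K Y"]) (use fK in \<open>auto simp: Off_def\<close>)
  have fT: "finite (T Y p)" for Y p
    by (rule finite_subset[of _ "S Y (fst p) \<times> S Y (snd p)"])
       (use fS in \<open>auto simp: T_def split: prod.splits\<close>)
  have S2: "2 \<le> card (S Y z)" if "z \<in> K Y" for Y z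
  proof -
    have "3 \<le> card (spots B (insert z Y))" using that unfolding K_def lines_def by auto
    then show ?thesis using diff_card_le_card_Diff[of "{z}" "spots B (insert z Y)"] unfolding S_def by simp
  qed
  \<comment> \<open>Each of the two lines has at least two points besides \<open>Y\<close>, so every
    \<open>y\<close> leaves some \<open>y'\<close> different from it.\<close>
  have T2: "2 \<le> card (T Y p)" if "p \<in> Off Y" for Y p
  proof -
    obtain z z' where p: "p = (z, z')" "z \<in> K Y" "z' \<in> K Y" using \<open>p \<in> Off Y\<close> unfolding Off_def by auto
    have "\<exists>y'\<in>S Y z'. y \<noteq> y'" for y
    proof (rule ccontr)
      assume "\<not> ?thesis"
      then have "S Y z' \<subseteq> {y}" by auto
      then have "card (S Y z') \<le> 1" using card_mono[of "{y}" "S Y z'"] by simp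
      then show False using S2[OF p(3)] by simp
    qed
    then have "\<exists>y'. (y, y') \<in> T Y p" if "y \<in> S Y z" for y using that unfolding T_def p by auto
    then have "S Y z \<subseteq> fst ` T Y p" by (metis fst_conv imageI subsetI)
    then have "card (S Y z) \<le> card (T Y p)"
      using card_image_le[OF fT, of fst Y p] card_mono[OF finite_imageI[OF fT]] le_trans by blast
    then show ?thesis using S2[OF p(2)] by simp
  qed
  have "2 * (\<Sum>Y\<in>B. card (K Y) * (card (K Y) - 1)) = (\<Sum>Y\<in>B. \<Sum>p\<in>Off Y. 2)"
    unfolding Off_def by (simp add: sum_distrib_left card_off_diagonal[OF fK] mult.commute)
  also have "\<dots> \<le> (\<Sum>Y\<in>B. \<Sum>p\<in>Off Y. card (T Y p))" using T2 by (intro sum_mono) auto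
  also have "\<dots> = card R" unfolding R_def using fB fO fT by simp
  also have "\<dots> = card (g ` R)"
  proof (rule card_image[symmetric])
    show "inj_on g R"
    proof (rule inj_onI)
      fix v v' assume v: "v \<in> R" "v' \<in> R" and e: "g v = g v'"
      obtain Y z z' y y' where v1: "v = (Y, (z, z'), (y, y'))" by (metis surj_pair)
      obtain Y1 z1 z1' y1 y1' where v2: "v' = (Y1, (z1, z1'), (y1, y1'))" by (metis surj_pair)
      have h: "z \<notin> Y" "z' \<notin> Y" "z \<noteq> z'" "y \<in> Y" "y' \<in> Y" "y \<noteq> y'"
        using v(1) unfolding v1 R_def Off_def T_def S_def K_def spots_def by auto
      have h1: "z1 \<notin> Y1" "z1' \<notin> Y1" "z1 \<noteq> z1'" "y1 \<in> Y1" "y1' \<in> Y1" "y1 \<noteq> y1'"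
        using v(2) unfolding v2 R_def Off_def T_def S_def K_def spots_def by auto
      have e': "insert z Y - {y} = insert z1 Y1 - {y1}" "insert z' Y - {y'} = insert z1' Y1 - {y1'}"
        "z = z1" "z' = z1'" using e unfolding v1 v2 g_def by auto
      \<comment> \<open>As \<open>g\<close> also records \<open>z\<close> and \<open>z'\<close>, the
        elements \<open>y'\<close> and \<open>y\<close> can be read off from the two
        differences.\<close>
      have d: "insert z Y - {y} - (insert z' Y - {y'}) = {z, y'}"
        "insert z' Y - {y'} - (insert z Y - {y}) = {z', y}" using h by blast+
      have d1: "insert z1 Y1 - {y1} - (insert z1' Y1 - {y1'}) = {z1, y1'}"
        "insert z1' Y1 - {y1'} - (insert z1 Y1 - {y1}) = {z1', y1}" using h1 by blast+
      have "{z, y'} = {z1, y1'}" "{z', y} = {z1', y1}"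
        using d d1 unfolding e'(1) e'(2) by simp_all
      then have "y' = y1'" "y = y1" unfolding doubleton_eq_iff using h h1 e'(3,4) by auto
      moreover have "Y = insert y (insert z Y - {y} - {z})" "Y1 = insert y1 (insert z1 Y1 - {y1} - {z1})"
        using h h1 by auto
      then have "Y = Y1" using e'(1,3) \<open>y = y1\<close> by simp
      ultimately show "v = v'" using e'(3,4) unfolding v1 v2 by simp
    qed
  qed
  also have "\<dots> \<le> card F"
  proof (rule card_mono)
    show "finite F" unfolding F_def
      by (rule finite_SigmaI) (use finite_near_far[OF u] fm in \<open>auto simp: far_def\<close>)
    show "g ` R \<subseteq> F"
    proof
      fix w assume "w \<in> g ` R"
      then obtain Y z z' y y' where v: "(Y, (z, z'), (y, y')) \<in> R"
        and w: "w = ((insert z Y - {y}, insert z' Y - {y'}), (z, z'))"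
        unfolding g_def by auto
      have h: "z \<notin> Y" "z' \<notin> Y" "z \<noteq> z'" "y \<in> Y" "y' \<in> Y" "y \<noteq> y'"
        "insert z Y - {y} \<in> B" "insert z' Y - {y'} \<in> B"
        using v unfolding R_def Off_def T_def S_def K_def spots_def by auto
      have d: "insert z Y - {y} - (insert z' Y - {y'}) = {z, y'}"
        "insert z' Y - {y'} - (insert z Y - {y}) = {z', y}" using h by blast+
      have "z \<noteq> y'" using h(1,5) by auto
      then have "card {z, y'} = 2" by simp
      then show "w \<in> F" unfolding F_def w far_def using h d by simp
    qed
  qed
  also have "card F = (\<Sum>w\<in>far B. card ((fst w - snd w) \<times> (snd w - fst w)))"
    unfolding F_def using finite_near_far[OF u] fm by (intro card_SigmaI) (auto simp: far_def)
  also have "\<dots> = (\<Sum>w\<in>far B. 4)"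
  proof (rule sum.cong[OF refl])
    fix w assume "w \<in> far B"
    then obtain P Q where w: "w = (P, Q)" "P \<in> B" "Q \<in> B" "card (P - Q) = 2" unfolding far_def by auto
    have "card (Q - P) = card (P - Q)" using fm[OF w(2)] fm[OF w(3)]
      by (metis card_le_sym_Diff le_antisym order_refl)
    then show "card ((fst w - snd w) \<times> (snd w - fst w)) = 4" using w by (simp add: card_cartesian_product)
  qed
  finally show ?thesis by simp
qed

lemma sum_lines_through:
  assumes u: "uniform q B"
  shows "3 * card (lines B) \<le> (\<Sum>Y\<in>B. card {z. z \<notin> Y \<and> insert z Y \<in> lines B})"
proof -
  have fB: "finite B" using u unfolding uniform_def by auto
  have fK: "finite {z. z \<notin> Y \<and> insert z Y \<in> lines B}" for Y by (rule finite_through[OF u])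
  have "(\<Sum>X\<in>lines B. 3) \<le> (\<Sum>X\<in>lines B. card (spots B X))"
    by (intro sum_mono) (simp add: lines_def)
  also have "\<dots> = card (SIGMA X:lines B. spots B X)"
    using finite_lines[OF u] finite_spots[OF u] by simp
  also have "\<dots> = card ((\<lambda>(X, x). (X - {x}, x)) ` (SIGMA X:lines B. spots B X))"
    by (rule card_image[symmetric]) (auto simp: inj_on_def spots_def)
  also have "\<dots> \<le> card (SIGMA Y:B. {z. z \<notin> Y \<and> insert z Y \<in> lines B})"
  proof (rule card_mono)
    show "finite (SIGMA Y:B. {z. z \<notin> Y \<and> insert z Y \<in> lines B})" using fB fK by blast
  qed (auto simp: spots_def insert_absorb)
  also have "\<dots> = (\<Sum>Y\<in>B. card {z. z \<notin> Y \<and> insert z Y \<in> lines B})" using fB fK by simp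
  finally show ?thesis by simp
qed

text \<open>With \<open>k\<close> lines through a point, \<open>k (k - 1)\<close> is bounded below by its tangent \<open>2 m k - m (m + 1)\<close>;
  the best choice of \<open>m\<close> is about the average of \<open>k\<close>.\<close>

lemma lines_rich_inequality:
  fixes m :: nat
  assumes u: "uniform q B" and V: "finite V" "\<And>W. W \<in> V \<Longrightarrow> card (spots B W) = 2"
  shows "(12 + 6 * m) * card (lines B) + 4 * card V \<le> 2 * (card B * (card B - 1)) + card B * (m * (m + 1))"
proof -
  let ?k = "\<lambda>Y. card {z. z \<notin> Y \<and> insert z Y \<in> lines B}"
  have "2 * m * ?k Y \<le> ?k Y * (?k Y - 1) + m * (m + 1)" for Y
  proof (cases "?k Y")
    case (Suc n)
    \<comment> \<open>For \<open>k = n + 1\<close> the gap between \<open>k (k - 1)\<close> and the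
      tangent is a product of two consecutive integers.\<close>
    have "0 \<le> (int n - int m) * (int n + 1 - int m)"
      by (simp add: zero_le_mult_iff) linarith
    then have "int (2 * m * Suc n) \<le> int (Suc n * n + m * (m + 1))"
      by (simp add: algebra_simps)
    then show ?thesis using Suc by (simp only: of_nat_le_iff diff_Suc_1)
  qed simp
  then have "(\<Sum>Y\<in>B. 2 * m * ?k Y) \<le> (\<Sum>Y\<in>B. ?k Y * (?k Y - 1) + m * (m + 1))" by (intro sum_mono)
  then have "2 * m * (\<Sum>Y\<in>B. ?k Y) \<le> (\<Sum>Y\<in>B. ?k Y * (?k Y - 1)) + card B * (m * (m + 1))"
    by (simp add: sum.distrib sum_distrib_left)
  also have "\<dots> \<le> 2 * card (far B) + card B * (m * (m + 1))" using card_far_ge[OF u] by simp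
  finally have "2 * m * (3 * card (lines B)) \<le> 2 * card (far B) + card B * (m * (m + 1))"
    using mult_le_mono2[OF sum_lines_through[OF u], of "2 * m"] by linarith
  \<comment> \<open>Near pairs used up by lines and by \<open>V\<close> are lost to
    \<open>far B\<close>.\<close>
  moreover have "6 * card (lines B) + 2 * card V + card (far B) \<le> card B * (card B - 1)"
    using card_near_ge[OF u V] card_near_far[OF u] by linarith
  moreover have "x + 2 * (6 * l + 2 * v) \<le> 2 * p + n" if "x \<le> 2 * w + n" "6 * l + 2 * v + w \<le> p" for x l v p n w :: nat
    using that by arith
  ultimately have "2 * m * (3 * card (lines B)) + 2 * (6 * card (lines B) + 2 * card V)
      \<le> 2 * (card B * (card B - 1)) + card B * (m * (m + 1))"
    by blast
  moreover have "(12 + 6 * m) * card (lines B) + 4 * card V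
      = 2 * m * (3 * card (lines B)) + 2 * (6 * card (lines B) + 2 * card V)"
    by (simp add: algebra_simps)
  ultimately show ?thesis by (simp only:)
qed

section \<open>Averaging the lines over all links\<close>

lemma sum_card_link:
  assumes "uniform q B" shows "(\<Sum>x\<in>\<Union>B. card (link B x)) = q * card B"
proof -
  have fB: "finite B" "finite (\<Union>B)" and fm: "\<And>Y. Y \<in> B \<Longrightarrow> card Y = q"
    using assms unfolding uniform_def by auto
  have "(\<Sum>x\<in>\<Union>B. card (link B x)) = (\<Sum>x\<in>\<Union>B. \<Sum>Y\<in>B. if x \<in> Y then 1 else 0)"
    unfolding card_link using fB by (simp add: sum.If_cases Int_def)
  also have "\<dots> = (\<Sum>Y\<in>B. \<Sum>x\<in>\<Union>B. if x \<in> Y then 1 else 0)" by (rule sum.swap)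
  also have "\<dots> = (\<Sum>Y\<in>B. card Y)"
  proof (rule sum.cong[OF refl])
    fix Y assume "Y \<in> B"
    then have "\<Union>B \<inter> Y = Y" by auto
    then show "(\<Sum>x\<in>\<Union>B. if x \<in> Y then 1 else 0) = card Y" using fB by (simp add: sum.If_cases)
  qed
  finally show ?thesis using fm by simp
qed

text \<open>A line \<open>X\<close> yields the line \<open>X - {x}\<close> of the link of
  \<open>x\<close> if three of its spots differ from \<open>x\<close>. With exactly three spots this
  holds for the \<open>q - 2\<close> other elements of \<open>X\<close>, with more spots for every
  element.\<close>

lemma sum_lines_link:
  assumes u: "uniform q B"
  shows "(q - 2) * card (lines B) \<le> (\<Sum>x\<in>\<Union>B. card (lines (link B x)))"
proof -
  define G where "G X = {x\<in>X. 3 \<le> card (spots B X - {x})}" for X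
  have fB: "finite (\<Union>B)" using u unfolding uniform_def by auto
  have X: "finite X" "card X = Suc q" "3 \<le> card (spots B X)" "finite (spots B X)" if "X \<in> lines B" for X
  proof -
    show 3: "3 \<le> card (spots B X)" using that unfolding lines_def by simp
    then have "spots B X \<noteq> {}" by auto
    then show "finite X" "card X = Suc q" using spot_finite_card[OF u] by auto
    show "finite (spots B X)" by (rule finite_spots[OF u])
  qed
  have "q - 2 \<le> card (G X)" if "X \<in> lines B" for X
  proof (cases "card (spots B X) = 3")
    case True
    have "X - spots B X \<subseteq> G X" unfolding G_def using True by auto
    moreover have "spots B X \<subseteq> X" unfolding spots_def by auto
    then have "card (X - spots B X) = q - 2" using X[OF that] True by (simp add: card_Diff_subset)
    ultimately show ?thesis using X(1)[OF that] card_mono[of "G X" "X - spots B X"] unfolding G_def by simp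
  next
    case False
    then have "G X = X" unfolding G_def using X[OF that] by (auto simp: card_Diff_singleton_if)
    then show ?thesis using X[OF that] by simp
  qed
  then have "(\<Sum>X\<in>lines B. q - 2) \<le> (\<Sum>X\<in>lines B. card (G X))" by (intro sum_mono)
  also have "\<dots> = card (SIGMA X:lines B. G X)"
    using finite_lines[OF u] X(1) unfolding G_def by (subst card_SigmaI) auto
  also have "\<dots> = card ((\<lambda>(X, x). (x, X - {x})) ` (SIGMA X:lines B. G X))"
    by (rule card_image[symmetric]) (auto simp: inj_on_def G_def)
  also have "\<dots> \<le> card (SIGMA x:\<Union>B. lines (link B x))"
  proof (rule card_mono)
    show "finite (SIGMA x:\<Union>B. lines (link B x))"
      using fB finite_lines[OF uniform_link[OF u]] by blast
    show "(\<lambda>(X, x). (x, X - {x})) ` (SIGMA X:lines B. G X) \<subseteq> (SIGMA x:\<Union>B. lines (link B x))"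
    proof clarify
      fix X x assume h: "X \<in> lines B" "x \<in> G X"
      then have x: "x \<in> X" and c: "3 \<le> card (spots B X - {x})" unfolding G_def by auto
      have "x \<in> \<Union>B" using lines_ground[of B X] h(1) x unfolding lines_def by auto
      moreover have "spots B X - {x} \<subseteq> spots (link B x) (X - {x})"
        using spots_insert[of x "X - {x}" B] x by (auto simp: insert_absorb split: if_splits)
      then have "card (spots B X - {x}) \<le> card (spots (link B x) (X - {x}))"
        by (rule card_mono[OF finite_spots[OF uniform_link[OF u]]])
      then have "X - {x} \<in> lines (link B x)" using c unfolding lines_def by simp
      ultimately show "x \<in> \<Union>B \<and> X - {x} \<in> lines (link B x)" by simp
    qed
  qed
  also have "\<dots> = (\<Sum>x\<in>\<Union>B. card (lines (link B x)))"
    using fB finite_lines[OF uniform_link[OF u]] by simp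
  finally show ?thesis by (simp add: mult.commute)
qed

text \<open>Summing the opposite inequality over the ground set would contradict
  \<open>sum_card_link\<close> and \<open>sum_lines_link\<close>. The factor 3 is the largest value
  of \<open>q / (q - 2)\<close> for \<open>q \<ge> 3\<close>.\<close>

lemma exists_rich_link:
  assumes u: "uniform q B" and q: "3 \<le> q" and ne: "B \<noteq> {}"
  shows "\<exists>x. 0 < card (link B x) \<and> card (lines B) * card (link B x) \<le> 3 * card B * card (lines (link B x))"
proof (rule ccontr)
  assume neg: "\<not> ?thesis"
  have fB: "finite (\<Union>B)" "finite B" using u unfolding uniform_def by auto
  have pos: "0 < card (link B x)" if "x \<in> \<Union>B" for x
    using that fB unfolding card_link by (auto simp: card_gt_0_iff)
  obtain Y where "Y \<in> B" using ne by auto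
  then have "Y \<noteq> {}" using u q unfolding uniform_def by auto
  then have "\<Union>B \<noteq> {}" using \<open>Y \<in> B\<close> by auto
  moreover have "3 * card B * card (lines (link B x)) < card (lines B) * card (link B x)" if "x \<in> \<Union>B" for x
    using neg pos[OF that] by (meson not_le)
  ultimately have "(\<Sum>x\<in>\<Union>B. 3 * card B * card (lines (link B x))) < (\<Sum>x\<in>\<Union>B. card (lines B) * card (link B x))"
    using fB by (intro sum_strict_mono) auto
  then have "3 * card B * (\<Sum>x\<in>\<Union>B. card (lines (link B x))) < card (lines B) * (q * card B)"
    unfolding sum_distrib_left[symmetric] sum_card_link[OF u] .
  moreover have "3 * card B * ((q - 2) * card (lines B)) \<le> 3 * card B * (\<Sum>x\<in>\<Union>B. card (lines (link B x)))"
    by (intro mult_le_mono2 sum_lines_link[OF u])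
  moreover have "(card B * card (lines B)) * q \<le> (card B * card (lines B)) * (3 * (q - 2))"
    using q by (intro mult_le_mono2) auto
  moreover have "card (lines B) * (q * card B) = (card B * card (lines B)) * q"
    "3 * card B * ((q - 2) * card (lines B)) = (card B * card (lines B)) * (3 * (q - 2))"
    by (simp_all only: ac_simps)
  ultimately show False by linarith
qed

section \<open>Saturated families around one element\<close>

lemma saturated_insert_image:
  assumes u: "uniform q B" and s: "saturated (link B x)"
  shows "saturated {Y\<in>B. x \<in> Y}"
proof -
  let ?M = "{Y\<in>B. x \<in> Y}"
  have uM: "uniform q ?M" using uniform_subset[OF u] by auto
  have lk: "link ?M x = link B x" unfolding link_def by auto
  have "card (spots ?M X) \<noteq> 2" for X
  proof (cases "x \<in> X")
    case True
    then have e: "insert x (X - {x}) = X" by auto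
    have "card (spots ?M X) = card (spots (link B x) (X - {x}))"
      using card_spots_insert[OF uM, of x "X - {x}"] unfolding e lk by simp
    then show ?thesis using s unfolding saturated_def by simp
  next
    case False
    then have "spots ?M X = {}" unfolding spots_def by auto
    then show ?thesis by simp
  qed
  then show ?thesis unfolding saturated_def by simp
qed

text \<open>A mixed set uses two ordered pairs of points of the link, a line of the link six. So
  both kinds together number at most \<open>C(d,2)\<close>, and each line of the link lowers this by
  two more.\<close>

lemma card_mixed_bound:
  assumes u: "uniform q B"
  shows "6 * card (lines (link B x)) + 2 * card (mixed B x) \<le> card (link B x) * (card (link B x) - 1)"
proof -
  have "finite (mixed B x)" using u unfolding mixed_def del_def uniform_def by auto
  then show ?thesis
    using card_near_ge[OF uniform_link[OF u], of "mixed B x" x] card_near_far[OF uniform_link[OF u], of x]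
    unfolding mixed_def by fastforce
qed

text \<open>The extremal case of \<open>d\<close> points through \<open>x\<close>: they and the mixed sets are the \<open>C(d + 1, 2)\<close> edges of a
  complete graph, up to a common core.\<close>

lemma saturated_cone:
  assumes u: "uniform q B" and nl: "lines (link B x) = {}"
    and full: "2 * card (mixed B x) = card (link B x) * (card (link B x) - 1)"
  shows "saturated ({Y\<in>B. x \<in> Y} \<union> mixed B x)"
proof -
  define L where "L = link B x"
  define U where "U = mixed B x"
  define M where "M = {Y\<in>B. x \<in> Y} \<union> U"
  have uL: "uniform (q - 1) L" unfolding L_def by (rule uniform_link[OF u])
  have fU: "finite U" using u unfolding U_def mixed_def del_def uniform_def by auto
  have U2: "card (spots L W) = 2" "x \<notin> W" "W \<in> B" if "W \<in> U" for W
    using that unfolding U_def L_def mixed_def del_def by auto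
  \<comment> \<open>Equality in the pair count makes the injection \<open>?g\<close> surjective onto
    \<open>?O\<close>. So \<open>L\<close> acts as the vertices and \<open>U\<close> as the edges of
    a complete graph.\<close>
  have cover: "Z \<union> Z' \<in> U" if Z: "Z \<in> L" "Z' \<in> L" "Z \<noteq> Z'" for Z Z'
  proof -
    let ?S = "SIGMA W:U. {(y, z). y \<in> spots L W \<and> z \<in> spots L W \<and> y \<noteq> z}"
    let ?g = "\<lambda>(X, y, z). (X - {y}, X - {z})"
    let ?O = "{(P, Q). P \<in> L \<and> Q \<in> L \<and> P \<noteq> Q}"
    have fL: "finite L" using uL unfolding uniform_def by simp
    have fO: "finite ?O" by (rule finite_subset[of _ "L \<times> L"]) (use fL in auto)
    have "card (?g ` ?S) = card ?S" by (rule card_image[OF inj_pairs_on_rich])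
    also have "\<dots> = 2 * card U" using card_pairs_on_rich[OF uL fU] U2 by simp
    also have "\<dots> = card ?O" unfolding card_off_diagonal[OF fL] using full unfolding U_def L_def by simp
    finally have "card (?g ` ?S) = card ?O" .
    moreover have "?g ` ?S \<subseteq> ?O"
    proof -
      have "near L \<subseteq> ?O" unfolding near_def by auto
      then show ?thesis using pairs_on_rich_near[of U L] by blast
    qed
    ultimately have "?g ` ?S = ?O" using card_subset_eq[OF fO] by blast
    moreover have "(Z, Z') \<in> ?O" using Z by simp
    ultimately have "(Z, Z') \<in> ?g ` ?S" by simp
    then obtain W y z where "W \<in> U" "y \<noteq> z" "Z = W - {y}" "Z' = W - {z}" by auto
    moreover from this have "Z \<union> Z' = W" by auto
    ultimately show ?thesis by simp
  qed
  have "M \<subseteq> B" using U2(3) unfolding M_def by auto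
  then have uM: "uniform q M" by (rule uniform_subset[OF u])
  have lk: "link M x = L" using U2 unfolding M_def L_def link_def by auto
  have "card (spots M X) \<noteq> 2" for X
  proof (cases "x \<in> X")
    case True
    define W where "W = X - {x}"
    have e: "insert x W = X" "x \<notin> W" using True unfolding W_def by auto
    have c: "card (spots M X) = card (spots L W) + (if W \<in> M then 1 else 0)"
      using card_spots_insert[OF uM e(2)] unfolding e lk .
    show ?thesis
    proof
      assume c2: "card (spots M X) = 2"
      show False
      proof (cases "W \<in> M")
        case True
        then have "W \<in> U" using e(2) unfolding M_def by auto
        then show False using c c2 U2(1) True by simp
      next
        case False
        then have "card (spots L W) = 2" using c c2 by simp
        then obtain y z where yz: "spots L W = {y, z}" "y \<noteq> z" by (meson card_2_iff)
        then have "W - {y} \<in> L" "W - {z} \<in> L" "y \<in> W" "z \<in> W" unfolding spots_def by auto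
        moreover from this yz have "W - {y} \<noteq> W - {z}" "(W - {y}) \<union> (W - {z}) = W" by auto
        ultimately have "W \<in> U" using cover by metis
        then show False using False unfolding M_def by simp
      qed
    qed
  next
    case False
    show ?thesis
    proof
      assume "card (spots M X) = 2"
      then obtain y1 y2 where y: "spots M X = {y1, y2}" "y1 \<noteq> y2" by (meson card_2_iff)
      define W1 where "W1 = X - {y1}"
      define W2 where "W2 = X - {y2}"
      have yX: "y1 \<in> X" "y2 \<in> X" using y unfolding spots_def by auto
      have W: "W1 \<in> U" "W2 \<in> U" "W1 \<noteq> W2" "W1 \<subseteq> X" "W2 \<subseteq> X"
        using y False yX unfolding W1_def W2_def spots_def M_def by auto
      have X: "finite X" "card X = Suc q" using spot_finite_card[OF uM, of y1 X] y by auto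
      \<comment> \<open>Rules out \<open>q = 0\<close>, where \<open>q - 1\<close> would not be the
        predecessor of \<open>q\<close>.\<close>
      have q1: "q = Suc (q - 1)"
      proof -
        obtain z where "z \<in> spots L W1" using U2(1)[OF W(1)] by fastforce
        then have "card W1 = Suc (q - 1)" using spot_finite_card[OF uL] by auto
        moreover have "card W1 = q" using U2(3)[OF W(1)] u unfolding uniform_def by auto
        ultimately show ?thesis by simp
      qed
      have pts: "card {Z\<in>L. Z \<subseteq> V} = 2" if "V \<in> U" for V
      proof -
        have "finite V" "card V = Suc (q - 1)" using U2(3)[OF that] u q1 unfolding uniform_def by auto
        then show ?thesis using card_points[OF uL] U2(1)[OF that] by simp
      qed
      obtain Z1 Z2 where Z12: "{Z\<in>L. Z \<subseteq> W1} = {Z1, Z2}" "Z1 \<noteq> Z2" using pts[OF W(1)] by (meson card_2_iff)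
      obtain Z3 Z4 where Z34: "{Z\<in>L. Z \<subseteq> W2} = {Z3, Z4}" "Z3 \<noteq> Z4" using pts[OF W(2)] by (meson card_2_iff)
      have un: "V = P \<union> Q" if V: "V \<in> U" "{Z\<in>L. Z \<subseteq> V} = {P, Q}" "P \<noteq> Q" for V P Q
      proof -
        have PQ: "P \<in> L" "Q \<in> L" "P \<subseteq> V" "Q \<subseteq> V" using V(2) by auto
        then have PU: "P \<union> Q \<in> U" using cover V(3) by auto
        have "finite V" "card V = card (P \<union> Q)"
          using PU V(1) U2(3) u unfolding uniform_def by auto
        then show ?thesis using card_subset_eq[of V "P \<union> Q"] PQ by auto
      qed
      \<comment> \<open>The edges \<open>W1\<close> and \<open>W2\<close> have different vertex
        pairs; a vertex \<open>P\<close> of \<open>W1\<close> only and a vertex \<open>Q\<close> of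
        \<open>W2\<close> only span a third edge inside \<open>X\<close>.\<close>
      have ne: "{Z1, Z2} \<noteq> {Z3, Z4}"
        using un[OF W(1) Z12] un[OF W(2) Z34] W(3) by (metis doubleton_eq_iff sup_commute)
      obtain P where P: "P \<in> {Z1, Z2}" "P \<notin> {Z3, Z4}" using ne Z12(2) Z34(2) by blast
      obtain Q where Q: "Q \<in> {Z3, Z4}" "Q \<notin> {Z1, Z2}" using ne Z12(2) Z34(2) by blast
      have "P \<in> {Z\<in>L. Z \<subseteq> W1}" "Q \<in> {Z\<in>L. Z \<subseteq> W2}" unfolding Z12(1) Z34(1) by (fact P(1) Q(1))+
      then have PQ: "P \<in> L" "Q \<in> L" "P \<subseteq> W1" "Q \<subseteq> W2" by simp_all
      have "P \<noteq> Q" using P Q by auto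
      then have V: "P \<union> Q \<in> U" using cover PQ by simp
      then have "P \<union> Q \<in> M" unfolding M_def by simp
      moreover have "P \<union> Q \<subseteq> X" using PQ W by auto
      ultimately obtain w where w: "w \<in> spots M X" "X - {w} = P \<union> Q"
        using spot_of_subset[OF uM _ _ X] by metis
      then have "P \<union> Q = W1 \<or> P \<union> Q = W2" using y(1) unfolding W1_def W2_def by auto
      then have "Q \<subseteq> W1 \<or> P \<subseteq> W2" by auto
      then have "Q \<in> {Z\<in>L. Z \<subseteq> W1} \<or> P \<in> {Z\<in>L. Z \<subseteq> W2}" using PQ by simp
      then show False using P Q unfolding Z12(1) Z34(1) by simp
    qed
  qed
  then show ?thesis unfolding saturated_def M_def U_def by simp
qed

section \<open>The cascade function and its inequalities\<close>

text \<open>The list of exceptions is found by running the induction numerically.\<close>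

definition slack :: "int \<Rightarrow> int" where
  "slack b = (if 61 < b then 0 else if b \<in> {24, 32} then 2 else if b \<in> {7, 8, 12, 13, 18, 25, 31, 40, 41, 50, 61} then 1 else 0)"

text \<open>\<open>C(c,3) + C(c1,2)\<close> in executable form; \<open>cascade_value_eq\<close>
  clears the divisions.\<close>

definition cascade_value :: "int \<Rightarrow> int \<Rightarrow> int" where
  "cascade_value c c1 = c * (c - 1) * (c - 2) div 6 + c1 * (c1 - 1) div 2"

text \<open>No family with \<open>b\<close> points can have \<open>a\<close> lines if averaging selects an element of degree \<open>d\<close>, where
  \<open>e = b - d\<close> and \<open>u\<close>, \<open>v\<close> bound the number of lines of the link and of the deletion; \<open>t\<close> runs
  through the possible numbers of lines of the link. The conditionals make the evaluation lazy.\<close>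

definition excluded :: "int \<Rightarrow> int \<Rightarrow> int \<Rightarrow> int \<Rightarrow> int \<Rightarrow> int \<Rightarrow> bool" where
  "excluded b a d e u v \<longleftrightarrow> (if e + u + v < a then True else if 3 * b * u < d * a then True else
     list_all (\<lambda>t. if 3 * b * t < d * a then True else if t + e + v < a then True else
        (let m = 3 * t div d in 2 * d * (d - 1) + d * (m * (m + 1)) < (12 + 6 * m) * t + 4 * (a - v - t))) [(d * a) div (3 * b)..u])"

text \<open>The scan runs through \<open>d, ..., n\<close> while maintaining \<open>d = C(j,2) + j1\<close>, \<open>b - d = C(i,2) + i1\<close> and
  \<open>s = (b - d) + h(d) + h(b - d) + 4 - a\<close>; as the slack is at most 2, a negative \<open>s\<close> excludes \<open>d\<close>.\<close>

function scan :: "int \<Rightarrow> int \<Rightarrow> int \<Rightarrow> int \<Rightarrow> int \<Rightarrow> int \<Rightarrow> int \<Rightarrow> int \<Rightarrow> int \<Rightarrow> int \<Rightarrow> bool" where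
  "scan n c1 b a d j j1 i i1 s = (if n < d then True else
     if (if s < 0 then True
         else if excluded b a d (b - d) (cascade_value j j1 + slack d) (cascade_value i i1 + slack (b - d)) then True else b - d = c1 \<and> c1 \<le> 3)
     then (if j1 + 1 < j
           then (if 0 < i1 then scan n c1 b a (d + 1) j (j1 + 1) i (i1 - 1) (s + (j1 - i1))
                 else scan n c1 b a (d + 1) j (j1 + 1) (i - 1) (i - 2) (s + (j1 - i) + 1))
           else (if 0 < i1 then scan n c1 b a (d + 1) (j + 1) 0 i (i1 - 1) (s + (j1 - i1))
                 else scan n c1 b a (d + 1) (j + 1) 0 (i - 1) (i - 2) (s + (j1 - i) + 1)))
     else False)"
  by auto
termination by (relation "measure (\<lambda>(n, c1, b, a, d, _). nat (n + 1 - d))") auto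

function decompose :: "int \<Rightarrow> int \<Rightarrow> int \<times> int" where
  "decompose b i = (if b < i \<or> i \<le> 0 then (i, b) else decompose (b - i) (i + 1))"
  by auto
termination by (relation "measure (\<lambda>(b, i). nat b)") auto

text \<open>The upper limit \<open>n = 0\<close> stands for \<open>b - 1\<close>. For triangular \<open>b\<close> (\<open>c1 = 0\<close>) already \<open>h(b)\<close> lines are excluded,
  so that families attaining \<open>h(b)\<close> have an element of small degree.\<close>

definition check :: "int \<Rightarrow> int \<Rightarrow> int \<Rightarrow> int \<Rightarrow> bool" where
  "check c c1 l n = (let b = c * (c - 1) div 2 + c1; a = (if c1 = 0 then cascade_value c 0 else cascade_value c c1 + slack b + 1) in 
     case decompose l 1 of (j, j1) \<Rightarrow> case decompose (b - l) 1 of (i, i1) \<Rightarrow>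
     scan (if n = 0 then b - 1 else n) c1 b a l j j1 i i1 (b - l + cascade_value j j1 + cascade_value i i1 + 4 - a))"

declare scan.simps [simp del] decompose.simps [simp del]

text \<open>For \<open>c \<le> 17\<close> all degrees from \<open>c\<close> to \<open>b - 1\<close>
  are settled by evaluation.\<close>

lemma small_check: "list_all (\<lambda>c. list_all (\<lambda>c1. check c c1 c 0) [0..c - 1]) [1..17]"
  by code_simp

text \<open>For \<open>18 \<le> c \<le> 36\<close> only this window is left open by the estimates:
  below it the link has too few lines, above it \<open>b - d\<close> is less than
  \<open>C(c - 2, 2)\<close>.\<close>

lemma mid_check:
  "list_all (\<lambda>c. list_all (\<lambda>c1. check c c1 ((c div 3 + 1) * (c div 3) div 2) (3 * c - 4)) [0..c - 1]) [18..36]"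
  by code_simp

text \<open>The form \<open>b = C(c,2) + c1\<close>, doubled to avoid division; \<open>b = 0\<close>
  is represented by \<open>c = 1\<close>.\<close>

definition tri_rep :: "int \<Rightarrow> int \<Rightarrow> int \<Rightarrow> bool" where
  "tri_rep b c c1 \<longleftrightarrow> 1 \<le> c \<and> 0 \<le> c1 \<and> c1 < c \<and> 2 * b = c * (c - 1) + 2 * c1"

lemma tri_even: "even (c * (c - 1))" for c :: int
  by auto

lemma two_tri_div: "2 * (c * (c - 1) div 2) = c * (c - 1)" for c :: int
  using tri_even by simp

lemma cascade_value_eq: "6 * cascade_value c c1 = c * (c - 1) * (c - 2) + 3 * (c1 * (c1 - 1))"
proof -
  have "2 dvd c * (c - 1) * (c - 2)" using tri_even by simp
  moreover have "3 dvd c \<or> 3 dvd c - 1 \<or> 3 dvd c - 2" by presburger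
  then have "3 dvd c * (c - 1) * (c - 2)" by auto
  moreover have "coprime 2 (3 :: int)" by simp
  ultimately have "2 * 3 dvd c * (c - 1) * (c - 2)" by (rule divides_mult)
  then have "6 dvd c * (c - 1) * (c - 2)" by simp
  then show ?thesis unfolding cascade_value_def using two_tri_div[of c1] by simp
qed

lemma tri_mono: "i \<le> j \<Longrightarrow> 0 \<le> i \<Longrightarrow> i * (i - 1) \<le> j * (j - 1)" for i j :: int
proof -
  assume "i \<le> j" "0 \<le> i"
  then have "j = 0 \<and> i = 0 \<or> 0 \<le> (j - i) * (i + j - 1)" by (cases "i + j \<ge> 1") auto
  then show ?thesis by (auto simp: algebra_simps)
qed

lemma tri_rep_le_index:
  assumes "tri_rep b c c1" "0 \<le> k" "k * (k - 1) \<le> 2 * b" shows "k \<le> c"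
proof (rule ccontr)
  assume "\<not> k \<le> c"
  then have "(c + 1) * c \<le> k * (k - 1)" using tri_mono[of "c + 1" k] assms unfolding tri_rep_def by simp
  then show False using assms unfolding tri_rep_def by (simp add: algebra_simps)
qed

lemma tri_rep_unique:
  assumes "tri_rep b c c1" "tri_rep b j j1" shows "j = c" "j1 = c1"
proof -
  have "j \<le> c" "c \<le> j"
    using tri_rep_le_index[OF assms(1), of j] tri_rep_le_index[OF assms(2), of c] assms unfolding tri_rep_def by auto
  then show "j = c" by simp
  then show "j1 = c1" using assms unfolding tri_rep_def by simp
qed

text \<open>\<open>decompose\<close> subtracts \<open>i\<close>, \<open>i + 1\<close>, ... in turn,
  so \<open>b + C(i,2)\<close> is invariant.\<close>

lemma tri_rep_decompose_aux:
  assumes "decompose b i = (c, c1)" "1 \<le> i" "0 \<le> b"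
  shows "i \<le> c \<and> 0 \<le> c1 \<and> c1 < c \<and> 2 * b + i * (i - 1) = c * (c - 1) + 2 * c1"
  using assms
proof (induction b i rule: decompose.induct)
  case (1 b i)
  show ?case
  proof (cases "b < i \<or> i \<le> 0")
    case True
    then have "decompose b i = (i, b)" by (subst decompose.simps) simp
    then show ?thesis using 1 True by auto
  next
    case False
    then have "decompose (b - i) (i + 1) = (c, c1)" using 1(2) by (subst (asm) decompose.simps) simp
    then show ?thesis using 1(1)[OF False] False 1(3,4) by (simp add: algebra_simps)
  qed
qed

lemma tri_rep_decompose: "0 \<le> b \<Longrightarrow> decompose b 1 = (c, c1) \<Longrightarrow> tri_rep b c c1"
  using tri_rep_decompose_aux[of b 1 c c1] unfolding tri_rep_def by simp

lemma tri_rep_exists: assumes "0 \<le> b" obtains c c1 where "tri_rep b c c1"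
  using tri_rep_decompose[OF assms] by (metis surj_pair)

definition cascade :: "int \<Rightarrow> int" where
  "cascade b = (case decompose b 1 of (c, c1) \<Rightarrow> cascade_value c c1)"

text \<open>The bound carried through the induction; beyond 61 it equals
  \<open>cascade\<close>.\<close>

definition cap :: "int \<Rightarrow> int" where
  "cap b = cascade b + slack b"

lemma cascade_rep:
  assumes "tri_rep b c c1" shows "cascade b = cascade_value c c1"
proof -
  obtain j j1 where j: "decompose b 1 = (j, j1)" by force
  have "0 \<le> c * (c - 1)" using assms unfolding tri_rep_def by simp
  then have "0 \<le> b" using assms unfolding tri_rep_def by linarith
  then have "tri_rep b j j1" using tri_rep_decompose j by simp
  then show ?thesis using tri_rep_unique[OF assms] j unfolding cascade_def by simp
qed

lemma cascade_eq: "tri_rep b c c1 \<Longrightarrow> 6 * cascade b = c * (c - 1) * (c - 2) + 3 * (c1 * (c1 - 1))"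
  using cascade_rep cascade_value_eq by simp

lemma slack_bounds: "0 \<le> slack b" "slack b \<le> 2" "61 < b \<Longrightarrow> slack b = 0"
  unfolding slack_def by auto

section \<open>Soundness of the evaluated exclusion tests\<close>

lemma excluded_sound:
  assumes "excluded b a d e u v" "0 < b" "0 < d" "t \<le> u" "w \<le> e" "x \<le> v + t + w" "d * x \<le> 3 * b * t" "0 \<le> t"
    and N: "\<And>m. 0 \<le> m \<Longrightarrow> (12 + 6 * m) * t + 4 * w \<le> 2 * d * (d - 1) + d * (m * (m + 1))"
  shows "x < a"
proof (rule ccontr)
  assume "\<not> x < a"
  then have ax: "a \<le> x" by simp
  then have da: "d * a \<le> 3 * b * t" using assms(3,7) mult_left_mono[of a x d] by linarith
  have "3 * b * t \<le> 3 * b * u" using assms by (intro mult_left_mono) auto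
  \<comment> \<open>The list starts where averaging allows \<open>t\<close> to start. Rounding down
    may admit a value that is too small; the first test inside the list dismisses it.\<close>
  then have t: "t \<in> set [(d * a) div (3 * b)..u]"
  proof -
    have "(d * a) div (3 * b) \<le> (3 * b * t) div (3 * b)" using da assms(2) by (intro zdiv_mono1) auto
    then show ?thesis using assms(2,4) by simp
  qed
  have "\<not> e + u + v < a" using ax assms by linarith
  moreover have "\<not> 3 * b * u < d * a" using da \<open>3 * b * t \<le> 3 * b * u\<close> by linarith
  ultimately have l: "list_all (\<lambda>t. if 3 * b * t < d * a then True else if t + e + v < a then True else
        (let m = 3 * t div d in 2 * d * (d - 1) + d * (m * (m + 1)) < (12 + 6 * m) * t + 4 * (a - v - t))) [(d * a) div (3 * b)..u]"
    using assms(1) unfolding excluded_def by simp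
  \<comment> \<open>If every line carries just three points, this is the average number of lines
    through a point of the link, rounded down.\<close>
  define m where "m = 3 * t div d"
  have "2 * d * (d - 1) + d * (m * (m + 1)) < (12 + 6 * m) * t + 4 * (a - v - t)"
    using l t da ax assms unfolding list_all_iff m_def Let_def by fastforce
  moreover have "0 \<le> m" unfolding m_def using assms by (simp add: pos_imp_zdiv_nonneg_iff)
  moreover have "4 * (a - v - t) \<le> 4 * w" using ax assms(6) by simp
  ultimately show False using N[of m] by linarith
qed

lemma cascade_value_step: "cascade_value j (j1 + 1) = cascade_value j j1 + j1" "j1 + 1 = j \<Longrightarrow> cascade_value (j + 1) 0 = cascade_value j j1 + j1"
proof -
  have "6 * cascade_value j (j1 + 1) = 6 * (cascade_value j j1 + j1)" unfolding distrib_left cascade_value_eq by (simp add: algebra_simps)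
  then show "cascade_value j (j1 + 1) = cascade_value j j1 + j1" by simp
  assume "j1 + 1 = j"
  then have j: "j1 = j - 1" by simp
  have "6 * cascade_value (j + 1) 0 = 6 * (cascade_value j j1 + j1)" unfolding j distrib_left cascade_value_eq by (simp add: algebra_simps)
  then show "cascade_value (j + 1) 0 = cascade_value j j1 + j1" by simp
qed

lemma tri_rep_up:
  assumes "tri_rep d j j1"
  shows "j1 + 1 < j \<Longrightarrow> tri_rep (d + 1) j (j1 + 1)" "\<not> j1 + 1 < j \<Longrightarrow> tri_rep (d + 1) (j + 1) 0"
  using assms unfolding tri_rep_def by (auto simp: algebra_simps)

lemma tri_rep_down:
  assumes "tri_rep e i i1" "1 \<le> e"
  shows "0 < i1 \<Longrightarrow> tri_rep (e - 1) i (i1 - 1)" "\<not> 0 < i1 \<Longrightarrow> tri_rep (e - 1) (i - 1) (i - 2)"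
proof -
  show "tri_rep (e - 1) i (i1 - 1)" if "0 < i1" using that assms unfolding tri_rep_def by auto
  assume "\<not> 0 < i1"
  then have "i \<noteq> 1" "i1 = 0" using assms unfolding tri_rep_def by auto
  then show "tri_rep (e - 1) (i - 1) (i - 2)" using assms unfolding tri_rep_def by (auto simp: algebra_simps)
qed

lemma scan_sound:
  assumes "scan n c1 b a d j j1 i i1 s" "tri_rep d j j1" "tri_rep (b - d) i i1"
    "s = b - d + cascade_value j j1 + cascade_value i i1 + 4 - a" "n < b" "d \<le> x" "x \<le> n"
  shows "excluded b a x (b - x) (cap x) (cap (b - x)) \<or> (b - x = c1 \<and> c1 \<le> 3)"
  using assms
proof (induction n c1 b a d j j1 i i1 s rule: scan.induct)
  case (1 n c1 b a d j j1 i i1 s)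
  have nd: "\<not> n < d" using 1 by simp
  have cp: "cap d = cascade_value j j1 + slack d" "cap (b - d) = cascade_value i i1 + slack (b - d)"
    using cascade_rep 1 unfolding cap_def by auto
  let ?ok = "if s < 0 then True
         else if excluded b a d (b - d) (cascade_value j j1 + slack d) (cascade_value i i1 + slack (b - d)) then True else b - d = c1 \<and> c1 \<le> 3"
  have ok: ?ok
  proof (rule ccontr)
    assume "\<not> ?ok"
    then show False using 1(5) nd by (subst (asm) scan.simps) (simp only: if_False if_True)
  qed
  show ?case
  proof (cases "x = d")
    case True
    show ?thesis
    proof (cases "s < 0")
      case True
      then have "b - d + cap d + cap (b - d) < a" using 1(8) cp slack_bounds(2)[of d] slack_bounds(2)[of "b - d"] by linarith
      then show ?thesis using \<open>x = d\<close> unfolding excluded_def by simp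
    next
      case False
      then show ?thesis using ok cp \<open>x = d\<close> by (auto split: if_splits)
    qed
  next
    case False
    then have x: "d + 1 \<le> x" using 1 by simp
    have e1: "1 \<le> b - d" using 1 by simp
    have be: "b - (d + 1) = b - d - 1" by simp
    \<comment> \<open>When \<open>d\<close> grows by one, \<open>h(d)\<close> gains
      \<open>j1\<close>, \<open>b - d\<close> loses one, and \<open>h(b - d)\<close> loses
      \<open>i1 - 1\<close> or, if \<open>i1 = 0\<close>, \<open>i - 2\<close>; this is the update
      of \<open>s\<close>.\<close>
    have ca: "cascade_value i (i1 - 1) = cascade_value i i1 - (i1 - 1)" using cascade_value_step(1)[of i "i1 - 1"] by simp
    have cb: "cascade_value (i - 1) (i - 2) = cascade_value i 0 - (i - 2)" using cascade_value_step(2)[of "i - 2" "i - 1"] by simp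
    note up = tri_rep_up[OF 1(6)] and down = tri_rep_down[OF 1(7) e1, folded be]
    have i0: "i1 = 0" if "\<not> 0 < i1" using that 1(7) unfolding tri_rep_def by simp
    have jj: "j1 + 1 = j" if "\<not> j1 + 1 < j" using that 1(6) unfolding tri_rep_def by simp
    show ?thesis
    proof (cases "j1 + 1 < j")
      case j: True
      show ?thesis
      proof (cases "0 < i1")
        case i: True
        have "scan n c1 b a (d + 1) j (j1 + 1) i (i1 - 1) (s + (j1 - i1))"
          using 1(5) nd ok i j by (subst (asm) scan.simps) (simp only: if_False if_True)
        then show ?thesis
          by (rule 1(1)[OF nd ok j i]) (use up down i j 1(8,9,11) x cascade_value_step ca in auto)
      next
        case i: False
        have "scan n c1 b a (d + 1) j (j1 + 1) (i - 1) (i - 2) (s + (j1 - i) + 1)"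
          using 1(5) nd ok i j by (subst (asm) scan.simps) (simp only: if_False if_True)
        then show ?thesis
          by (rule 1(2)[OF nd ok j i]) (use up down i j 1(8,9,11) x cascade_value_step cb i0 in auto)
      qed
    next
      case j: False
      show ?thesis
      proof (cases "0 < i1")
        case i: True
        have "scan n c1 b a (d + 1) (j + 1) 0 i (i1 - 1) (s + (j1 - i1))"
          using 1(5) nd ok i j by (subst (asm) scan.simps) (simp only: if_False if_True)
        then show ?thesis
          by (rule 1(3)[OF nd ok j i]) (use up down i j 1(8,9,11) x cascade_value_step(2)[OF jj[OF j]] ca in auto)
      next
        case i: False
        have "scan n c1 b a (d + 1) (j + 1) 0 (i - 1) (i - 2) (s + (j1 - i) + 1)"
          using 1(5) nd ok i j by (subst (asm) scan.simps) (simp only: if_False if_True)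
        then show ?thesis
          by (rule 1(4)[OF nd ok j i]) (use up down i j 1(8,9,11) x cascade_value_step(2)[OF jj[OF j]] cb i0 in auto)
      qed
    qed
  qed
qed

lemma check_sound:
  assumes c: "check c c1 l n" and r: "tri_rep b c c1" and x: "0 \<le> l" "l \<le> x" "x \<le> (if n = 0 then b - 1 else n)" "x < b" "n < b"
  shows "excluded b (if c1 = 0 then cascade b else cap b + 1) x (b - x) (cap x) (cap (b - x)) \<or> (b - x = c1 \<and> c1 \<le> 3)"
proof -
  have b: "c * (c - 1) div 2 + c1 = b" using r two_tri_div[of c] unfolding tri_rep_def by linarith
  obtain j j1 where j: "decompose l 1 = (j, j1)" by force
  obtain i i1 where i: "decompose (b - l) 1 = (i, i1)" by force
  have a: "(if c1 = 0 then cascade_value c 0 else cascade_value c c1 + slack b + 1) = (if c1 = 0 then cascade b else cap b + 1)"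
    using cascade_rep[OF r] unfolding cap_def by simp
  have "scan (if n = 0 then b - 1 else n) c1 b (if c1 = 0 then cascade b else cap b + 1) l j j1 i i1
     (b - l + cascade_value j j1 + cascade_value i i1 + 4 - (if c1 = 0 then cascade b else cap b + 1))"
    using c unfolding check_def b Let_def a i j by simp
  then show ?thesis
    by (rule scan_sound) (use tri_rep_decompose i j x in auto)
qed

lemma slack_rep:
  assumes r: "tri_rep b c c1" and s: "slack b \<noteq> 0"
  shows "4 \<le> c" "c1 \<noteq> 0" "slack b = 2 \<Longrightarrow> (b = 24 \<and> c = 7 \<and> c1 = 3) \<or> (b = 32 \<and> c = 8 \<and> c1 = 4)"
proof -
  have c: "tri_rep 7 4 1" "tri_rep 8 4 2" "tri_rep 12 5 2" "tri_rep 13 5 3" "tri_rep 18 6 3" "tri_rep 24 7 3" "tri_rep 25 7 4"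
    "tri_rep 31 8 3" "tri_rep 32 8 4" "tri_rep 40 9 4" "tri_rep 41 9 5" "tri_rep 50 10 5" "tri_rep 61 11 6"
    unfolding tri_rep_def by simp_all
  have "b \<in> {7, 8, 12, 13, 18, 24, 25, 31, 32, 40, 41, 50, 61}"
    using s unfolding slack_def by (auto split: if_splits)
  then have "4 \<le> c \<and> 0 < c1" using tri_rep_unique[OF r] c by auto
  then show "4 \<le> c" "c1 \<noteq> 0" by auto
  assume "slack b = 2"
  then have "b = 24 \<or> b = 32" unfolding slack_def by (auto split: if_splits)
  then show "(b = 24 \<and> c = 7 \<and> c1 = 3) \<or> (b = 32 \<and> c = 8 \<and> c1 = 4)" using tri_rep_unique[OF r] c by auto
qed

section \<open>Linear bounds on the cascade function\<close>

lemma cap_le: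
  assumes r: "tri_rep d j j1" shows "3 * cap d \<le> d * (j - 1)"
proof -
  have h: "1 \<le> j" "0 \<le> j1" "j1 < j" "2 * d = j * (j - 1) + 2 * j1" using r unfolding tri_rep_def by auto
  have "2 * (d * (j - 1)) = (j * (j - 1) + 2 * j1) * (j - 1)" using h(4) by (metis mult.assoc)
  then have e: "2 * (d * (j - 1)) = 6 * cascade d + (j - j1) * (j + 3 * j1 - 1)"
    using cascade_eq[OF r] by (simp add: algebra_simps)
  have "6 * slack d \<le> (j - j1) * (j + 3 * j1 - 1)"
  proof (cases "slack d = 0")
    case True
    then show ?thesis using h by simp
  next
    case False
    then have j: "4 \<le> j" using slack_rep[OF r] by simp
    \<comment> \<open>With \<open>k = j - 1 - j1\<close> the product is
      \<open>4 * j - 4 + k * (4 * j - 7 - 3 * k)\<close>, hence at least 12, which covers six times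
      the largest slack.\<close>
    have "0 \<le> (j - 1 - j1) * (4 * j - 7 - 3 * (j - 1 - j1))" using h j by simp
    then have "4 * j - 4 \<le> (j - j1) * (j + 3 * j1 - 1)" by (simp add: algebra_simps)
    then show ?thesis using j slack_bounds(2)[of d] by linarith
  qed
  then show ?thesis using e unfolding cap_def by simp
qed

text \<open>For \<open>c1 = 0\<close> the factor is exactly \<open>3 * c - 6\<close>
  (\<open>cascade_triangular\<close>); lowering it by one covers every \<open>c1\<close>, the gap
  being smallest for \<open>c1\<close> near \<open>c / 3\<close>.\<close>

lemma cascade_ge:
  assumes r: "tri_rep b c c1" shows "b * (3 * c - 7) \<le> 9 * cascade b"
proof -
  have h: "1 \<le> c" "0 \<le> c1" "c1 < c" "2 * b = c * (c - 1) + 2 * c1" using r unfolding tri_rep_def by auto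
  have "2 * (b * (3 * c - 7)) = (c * (c - 1) + 2 * c1) * (3 * c - 7)" using h(4) by (metis mult.assoc)
  then have e: "18 * cascade b = 2 * (b * (3 * c - 7)) + ((c - 3 * c1) * (c - 3 * c1) - (c - 5 * c1))"
    using cascade_eq[OF r] by (simp add: algebra_simps)
  have "c - 5 * c1 \<le> (c - 3 * c1) * (c - 3 * c1)"
  proof (cases "c - 5 * c1 \<le> 0")
    case True
    then show ?thesis using zero_le_square[of "c - 3 * c1"] by linarith
  next
    case False
    then have "1 * (c - 3 * c1) \<le> (c - 3 * c1) * (c - 3 * c1)" using h by (intro mult_right_mono) auto
    then have "c - 3 * c1 \<le> (c - 3 * c1) * (c - 3 * c1)" by simp
    then show ?thesis using h by linarith
  qed
  then show ?thesis using e by linarith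
qed

lemma cascade_triangular:
  assumes r: "tri_rep b c 0" shows "3 * cascade b = b * (c - 2)"
proof -
  have "2 * b = c * (c - 1)" using r unfolding tri_rep_def by auto
  then have "2 * (b * (c - 2)) = c * (c - 1) * (c - 2)" by (metis mult.assoc)
  then show ?thesis using cascade_eq[OF r] by linarith
qed

text \<open>By the bounds \<open>3 h(d) \<le> d (j - 1)\<close> and \<open>9 h(b) \<ge> b (3 c - 7)\<close> this implies \<open>e + h(d) + h(e) \<le> h(b)\<close>.\<close>

lemma crude_inequality:
  assumes rb: "tri_rep b c c1" and rd: "tri_rep d j j1" and re: "tri_rep e i i1" and b: "b = d + e"
    and c: "18 \<le> c" "c \<le> d" "c \<le> e" "c < 3 * j" and ic: "i \<le> c - 3 \<or> 37 \<le> c"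
  shows "0 \<le> d * (3 * c - 4 - 3 * j) + e * (3 * c - 13 - 3 * i)"
proof -
  have hb: "0 \<le> c1" "c1 \<le> c - 1" "2 * b = c * (c - 1) + 2 * c1" using rb unfolding tri_rep_def by auto
  have hd: "1 \<le> j" "0 \<le> j1" "j1 < j" "2 * d = j * (j - 1) + 2 * j1" using rd unfolding tri_rep_def by auto
  have he: "1 \<le> i" "0 \<le> i1" "i1 \<le> i - 1" "2 * e = i * (i - 1) + 2 * i1" using re unfolding tri_rep_def by auto
  have ub: "2 * b \<le> c * c + c - 2" using hb by (simp add: algebra_simps)
  have lb: "c * c - c \<le> 2 * b" using hb by (simp add: algebra_simps)
  have jc: "j \<le> c - 1" and icc: "i \<le> c - 1"
  proof -
    have "\<not> c \<le> j" using tri_mono[of c j] hb hd c b by (auto simp: algebra_simps)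
    then show "j \<le> c - 1" by simp
    have "\<not> c \<le> i" using tri_mono[of c i] hb he c b by (auto simp: algebra_simps)
    then show "i \<le> c - 1" by simp
  qed
  have jd: "j * (j - 1) \<le> 2 * d" using hd by simp
  show ?thesis
  proof (cases "j = c - 1")
    case True
    \<comment> \<open>Here \<open>d\<close> has coefficient -1. As \<open>e\<close> is at most
      \<open>2 * c - 2\<close>, the index \<open>i\<close> is of the order of the square root of
      \<open>c\<close>, and the coefficient of \<open>e\<close> is large.\<close>
    have "2 * e \<le> 4 * c - 4" using hb hd(2,4) b unfolding True by (simp add: algebra_simps)
    then have ie: "i * (i - 1) \<le> 4 * c - 4" using he by simp
    have "6 * i \<le> 5 * c - 25"
    proof (rule ccontr)
      assume "\<not> ?thesis"
      then have "(5 * c - 24) * (5 * c - 30) \<le> (6 * i) * (6 * i - 6)" using c by (intro mult_mono) auto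
      then have "25 * (c * c) \<le> 414 * c - 864" using ie by (simp add: algebra_simps)
      moreover have "18 * c \<le> c * c" using c by (intro mult_right_mono) auto
      ultimately show False using c by linarith
    qed
    then have "c * (c + 1) \<le> e * (2 * (3 * c - 12 - 3 * i))" using c by (intro mult_mono) auto
    then have "b \<le> e * (3 * c - 12 - 3 * i)" using ub by (simp add: algebra_simps)
    then show ?thesis unfolding True b by (simp add: algebra_simps)
  next
    case False
    then have j2: "j \<le> c - 2" using jc by simp
    define w where "w = 3 * c - 4 - 3 * j"
    have w: "2 \<le> w" using j2 unfolding w_def by simp
    \<comment> \<open>The coefficient of \<open>e\<close> is nonnegative for
      \<open>i \<le> c - 5\<close>, and -1, -4, -7 for the next three values of \<open>i\<close>. A
      larger \<open>i\<close> leaves a smaller \<open>d\<close> and \<open>j\<close>, hence a larger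
      weight \<open>w\<close> of \<open>d\<close> to compensate.\<close>
    consider "i \<le> c - 5" | "i = c - 4" | "i = c - 3" | "i = c - 2" "37 \<le> c" | "i = c - 1" "37 \<le> c"
      using ic icc by linarith
    then show ?thesis
    proof cases
      case 1
      then show ?thesis using c j2 by (intro add_nonneg_nonneg mult_nonneg_nonneg) auto
    next
      case 2
      have e2: "2 * e \<le> c * c - 7 * c + 10" using he(3,4) unfolding 2 by (simp add: algebra_simps)
      have d1: "3 * c - 5 \<le> d" using e2 lb b by linarith
      have "2 * d \<le> 10 * c - 22" using he(2,4) ub b unfolding 2 by (simp add: algebra_simps)
      then have jj: "j * (j - 1) \<le> 10 * c - 22" using jd by linarith
      have "18 * j \<le> 17 * c - 21"
      proof (rule ccontr)
        assume "\<not> ?thesis"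
        then have "(17 * c - 20) * (17 * c - 38) \<le> (18 * j) * (18 * j - 18)" using c by (intro mult_mono) auto
        then have "289 * (c * c) \<le> 4226 * c - 7888" using jj by (simp add: algebra_simps)
        moreover have "18 * c \<le> c * c" using c by (intro mult_right_mono) auto
        ultimately show False using c by linarith
      qed
      then have "(3 * c - 5) * (c - 3) \<le> d * (6 * w)" using c d1 unfolding w_def by (intro mult_mono) auto
      then have "e \<le> d * w" using e2 c by (simp add: algebra_simps)
      then show ?thesis unfolding 2 w_def by (simp add: algebra_simps)
    next
      case 3
      have e2: "2 * e \<le> c * c - 5 * c + 4" using he(3,4) unfolding 3 by (simp add: algebra_simps)
      have d1: "2 * c - 2 \<le> d" using e2 lb b by linarith
      have "2 * d \<le> 8 * c - 14" using he(2,4) ub b unfolding 3 by (simp add: algebra_simps)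
      then have jj: "j * (j - 1) \<le> 8 * c - 14" using jd by linarith
      have "3 * j \<le> 2 * c - 1"
      proof (rule ccontr)
        assume "\<not> ?thesis"
        then have "(2 * c) * (2 * c - 3) \<le> (3 * j) * (3 * j - 3)" using c by (intro mult_mono[of "2 * c" "3 * j"]) auto
        then have "4 * (c * c) \<le> 78 * c - 126" using jj by (simp add: algebra_simps)
        moreover have "0 \<le> (c - 18) * (4 * c - 6)" using c by simp
        then have "0 \<le> 4 * (c * c) - 78 * c + 108" by (simp add: algebra_simps)
        ultimately show False by linarith
      qed
      then have "(2 * c - 2) * (c - 3) \<le> d * w" using c d1 unfolding w_def by (intro mult_mono) auto
      then have "4 * e \<le> d * w" using e2 c by (simp add: algebra_simps)
      then show ?thesis unfolding 3 w_def by (simp add: algebra_simps)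
    next
      case 4
      have e2: "2 * e \<le> c * c - 3 * c" using he(3,4) unfolding 4 by (simp add: algebra_simps)
      have "2 * d \<le> 6 * c - 8" using he(2,4) ub b unfolding 4 by (simp add: algebra_simps)
      then have jj: "j * (j - 1) \<le> 6 * c - 8" using jd by linarith
      have "2 * j \<le> c - 7"
      proof (rule ccontr)
        assume "\<not> ?thesis"
        then have "(c - 6) * (c - 8) \<le> (2 * j) * (2 * j - 2)" using c by (intro mult_mono) auto
        then have "c * c \<le> 38 * c - 80" using jj by (simp add: algebra_simps)
        moreover have "37 * c \<le> c * c" using 4 by (intro mult_right_mono) auto
        moreover have "0 \<le> (c - 37) * (c - 1)" using 4 by simp
        then have "0 \<le> c * c - 38 * c + 37" by (simp add: algebra_simps)
        ultimately show False by linarith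
      qed
      then have w2: "3 * c + 13 \<le> 2 * w" unfolding w_def by simp
      have "(c + 1) * (c - 2) \<le> (3 * j) * (3 * j - 3)" using c by (intro mult_mono) auto
      then have "(c + 1) * (c - 2) \<le> 18 * d" using jd by (simp add: algebra_simps)
      then have "((c + 1) * (c - 2)) * (3 * c + 13) \<le> (18 * d) * (2 * w)"
        using w2 c by (intro mult_mono[of "(c + 1) * (c - 2)" "18 * d"]) auto
      moreover have "126 * (c * c - 3 * c) \<le> ((c + 1) * (c - 2)) * (3 * c + 13)"
      proof -
        have "0 \<le> (c - 37) * (3 * c - 5)" using 4 by simp
        then have "0 \<le> c * ((c - 37) * (3 * c - 5))" using c by simp
        then show ?thesis using c by (simp add: algebra_simps)
      qed
      ultimately have "7 * e \<le> d * w" using e2 by (simp add: algebra_simps)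
      then show ?thesis unfolding 4 w_def by (simp add: algebra_simps)
    next
      case 5
      have "2 * d \<le> 4 * c - 4" using he(2,4) ub b unfolding 5 by (simp add: algebra_simps)
      then have jj: "j * (j - 1) \<le> 4 * c - 4" using jd by linarith
      \<comment> \<open>From \<open>c < 3 * j\<close> and \<open>d \<le> 2 * c - 2\<close>: the
        threshold 37 makes \<open>i = c - 1\<close> impossible.\<close>
      have "(c + 1) * (c - 2) \<le> (3 * j) * (3 * j - 3)" using c by (intro mult_mono) auto
      then have "c * c \<le> 37 * c - 34" using jj by (simp add: algebra_simps)
      moreover have "37 * c \<le> c * c" using 5 by (intro mult_right_mono) auto
      ultimately show ?thesis by linarith
    qed
  qed
qed

section \<open>Removing fewer than \<open>c\<close> points, and the exclusion of degrees from
  \<open>c\<close> on\<close>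

lemma cap_small: assumes "4 \<le> e" shows "2 * cap e + 2 * e < e * (e - 1)"
proof -
  obtain i i1 where r: "tri_rep e i i1" using tri_rep_exists[of e] assms by auto
  have h: "1 \<le> i" "0 \<le> i1" "i1 < i" "2 * e = i * (i - 1) + 2 * i1" using r unfolding tri_rep_def by auto
  have c: "3 * cap e \<le> e * (i - 1)" by (rule cap_le[OF r])
  show ?thesis
  proof (cases "e = 4")
    \<comment> \<open>At \<open>e = 4\<close> the linear bound does not yield strictness, so
      \<open>cap 4 = 1\<close> is computed.\<close>
    case True
    have "tri_rep 4 3 1" unfolding tri_rep_def by simp
    then have "cap e = 1" using cascade_eq[of 4 3 1] True unfolding cap_def slack_def by simp
    then show ?thesis using True by simp
  next
    case False
    have "2 * i + 7 < 3 * e"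
    proof (cases "i \<le> 3")
      case True
      then show ?thesis using False assms by simp
    next
      case False
      then have "4 * (i - 1) \<le> i * (i - 1)" by (intro mult_right_mono) auto
      then have "2 * (i - 1) \<le> e" using h by linarith
      then show ?thesis using False by simp
    qed
    then have "2 * (i - 1) + 6 < 3 * (e - 1)" by simp
    then have "e * (2 * (i - 1) + 6) < e * (3 * (e - 1))" using assms by (intro mult_strict_left_mono) auto
    then show ?thesis using c by (simp add: algebra_simps)
  qed
qed

text \<open>\<open>h(b) - h(b - d)\<close> exceeds \<open>C(d,2)\<close> by a product that vanishes
  only for \<open>d = c1\<close> and \<open>d = c - 1\<close>; the induction treats these two
  degrees separately.\<close>

lemma low_cascade:
  assumes r: "tri_rep b c c1" and d: "1 \<le> d" "d \<le> c - 1"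
  shows "d \<le> c1 \<Longrightarrow> tri_rep (b - d) c (c1 - d) \<and> 2 * cascade (b - d) + d * (d - 1) + 2 * (d * (c1 - d)) = 2 * cascade b"
    and "c1 < d \<Longrightarrow> tri_rep (b - d) (c - 1) (c - 1 - d + c1) \<and>
      2 * cascade (b - d) + d * (d - 1) + 2 * ((c - 1 - d) * (d - c1)) = 2 * cascade b"
proof -
  have h: "1 \<le> c" "0 \<le> c1" "c1 < c" "2 * b = c * (c - 1) + 2 * c1" using r unfolding tri_rep_def by auto
  show "tri_rep (b - d) c (c1 - d) \<and> 2 * cascade (b - d) + d * (d - 1) + 2 * (d * (c1 - d)) = 2 * cascade b" if "d \<le> c1"
  proof
    show r': "tri_rep (b - d) c (c1 - d)" using h d that unfolding tri_rep_def by auto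
    show "2 * cascade (b - d) + d * (d - 1) + 2 * (d * (c1 - d)) = 2 * cascade b"
      using cascade_eq[OF r] cascade_eq[OF r'] by (simp add: algebra_simps)
  qed
  show "tri_rep (b - d) (c - 1) (c - 1 - d + c1) \<and>
      2 * cascade (b - d) + d * (d - 1) + 2 * ((c - 1 - d) * (d - c1)) = 2 * cascade b" if "c1 < d"
  proof
    show r': "tri_rep (b - d) (c - 1) (c - 1 - d + c1)" using h d that unfolding tri_rep_def by (auto simp: algebra_simps)
    show "2 * cascade (b - d) + d * (d - 1) + 2 * ((c - 1 - d) * (d - c1)) = 2 * cascade b"
      using cascade_eq[OF r] cascade_eq[OF r'] by (simp add: algebra_simps)
  qed
qed

text \<open>Here only \<open>e\<close> points avoid \<open>x\<close>. By \<open>low_cascade\<close>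
  with \<open>e\<close> in place of \<open>d\<close>, the gain \<open>h(b) - h(b - e)\<close> is at
  least \<open>C(e,2)\<close>, which beats \<open>e + cap e\<close> from \<open>e = 4\<close> on;
  for smaller \<open>e\<close> the product term helps, unless it vanishes at
  \<open>e = c1\<close>.\<close>

lemma large_degree_excluded:
  assumes r: "tri_rep b c c1" and c: "18 \<le> c" and e: "1 \<le> e" "e \<le> c - 1" and H: "\<not> (e = c1 \<and> c1 \<le> 3)"
  shows "e + cap (b - e) + cap e < (if c1 = 0 then cascade b else cap b + 1)"
proof -
  have h: "0 \<le> c1" "c1 < c" "2 * b = c * (c - 1) + 2 * c1" using r unfolding tri_rep_def by auto
  have big: "18 * (c - 1) \<le> c * (c - 1)" using c by (intro mult_right_mono) auto
  then have "61 < b - e" "61 < b" using h c e by (simp_all add: right_diff_distrib)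
  then have s: "cap b = cascade b" "cap (b - e) = cascade (b - e)" unfolding cap_def using slack_bounds(3) by auto
  have small: "cap e \<le> 1" "e = 1 \<or> e = 2 \<Longrightarrow> cap e = 0" if "e \<le> 3"
  proof -
    have "tri_rep 1 2 0" "tri_rep 2 2 1" "tri_rep 3 3 0" unfolding tri_rep_def by auto
    then have "cascade 1 = 0" "cascade 2 = 0" "cascade 3 = 1" using cascade_eq by force+
    moreover have "e = 1 \<or> e = 2 \<or> e = 3" using e that by linarith
    ultimately show "cap e \<le> 1" "e = 1 \<or> e = 2 \<Longrightarrow> cap e = 0" unfolding cap_def slack_def by auto
  qed
  show ?thesis
  proof (cases "e \<le> c1")
    case True
    have q: "2 * cascade (b - e) + e * (e - 1) + 2 * (e * (c1 - e)) = 2 * cascade b"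
      using low_cascade(1)[OF r e True] by simp
    have "2 * cap e + 2 * e \<le> e * (e - 1) + 2 * (e * (c1 - e))"
    proof (cases "4 \<le> e")
      case True
      have "0 \<le> e * (c1 - e)" using \<open>e \<le> c1\<close> e by simp
      then show ?thesis using cap_small[OF True] by linarith
    next
      case False
      then have "1 \<le> c1 - e" using \<open>e \<le> c1\<close> H by linarith
      then have "e * 1 \<le> e * (c1 - e)" using e by (intro mult_left_mono) auto
      moreover have "e = 1 \<or> e = 2 \<or> e = 3" using e False by linarith
      ultimately show ?thesis using small by auto
    qed
    then show ?thesis using q True e s by simp
  next
    case False
    have q: "2 * cascade (b - e) + e * (e - 1) + 2 * ((c - 1 - e) * (e - c1)) = 2 * cascade b"
      using low_cascade(2)[OF r e] False by simp
    have n: "0 \<le> (c - 1 - e) * (e - c1)" using e False by simp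
    have "2 * cap e + 2 * e < e * (e - 1) + 2 * ((c - 1 - e) * (e - c1))"
    proof (cases "4 \<le> e")
      case True
      then show ?thesis using cap_small[OF True] n by linarith
    next
      case e3: False
      have "(c - 1 - e) * 1 \<le> (c - 1 - e) * (e - c1)" using e False by (intro mult_left_mono) auto
      then have "c - 1 - e \<le> (c - 1 - e) * (e - c1)" by simp
      moreover have "0 \<le> e * (e - 1)" using e by simp
      ultimately show ?thesis using small(1) e3 c by linarith
    qed
    then show ?thesis using q s by simp
  qed
qed

text \<open>Five regimes: evaluation for \<open>c \<le> 17\<close>,
  \<open>large_degree_excluded\<close> for \<open>b - d < c\<close>, the averaging test for
  \<open>3 * j \<le> c\<close>, \<open>crude_inequality\<close>, and the window of
  \<open>mid_check\<close>.\<close>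

lemma high_excluded:
  assumes r: "tri_rep b c c1" and d: "c \<le> d" "d < b" and H: "\<not> (b - d = c1 \<and> c1 \<le> 3)"
  shows "excluded b (if c1 = 0 then cascade b else cap b + 1) d (b - d) (cap d) (cap (b - d))"
proof -
  let ?a = "if c1 = 0 then cascade b else cap b + 1"
  let ?e = "b - d"
  have h: "1 \<le> c" "0 \<le> c1" "c1 < c" "2 * b = c * (c - 1) + 2 * c1" using r unfolding tri_rep_def by auto
  show ?thesis
  proof (cases "c \<le> 17")
    case True
    have "c \<in> set [1..17]" "c1 \<in> set [0..c - 1]"
      unfolding set_upto atLeastAtMost_iff using True h by auto
    then have "check c c1 c 0" using small_check unfolding list_all_iff by blast
    then show ?thesis using check_sound[of c c1 c 0 b d] r d H h by auto
  next
    case False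
    then have c: "18 \<le> c" by simp
    show ?thesis
    proof (cases "?e < c")
      case True
      then have "?e + cap (b - ?e) + cap ?e < ?a"
        using large_degree_excluded[OF r c, of ?e] d H by simp
      then show ?thesis unfolding excluded_def by simp
    next
      case ce: False
      obtain j j1 where rd: "tri_rep d j j1" using tri_rep_exists[of d] d h by auto
      obtain i i1 where re: "tri_rep ?e i i1" using tri_rep_exists[of ?e] d by auto
      have hd: "1 \<le> j" "0 \<le> j1" "j1 < j" "2 * d = j * (j - 1) + 2 * j1" using rd unfolding tri_rep_def by auto
      have he: "1 \<le> i" "0 \<le> i1" "i1 < i" "2 * ?e = i * (i - 1) + 2 * i1" using re unfolding tri_rep_def by auto
      have cd: "3 * cap d \<le> d * (j - 1)" and cce: "3 * cap ?e \<le> ?e * (i - 1)" using cap_le rd re by auto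
      have cb: "b * (3 * c - 7) \<le> 9 * cascade b" by (rule cascade_ge[OF r])
      have a: "cascade b \<le> ?a" using slack_bounds(1)[of b] unfolding cap_def by simp
      have b0: "0 < b" "0 < d" using d c by auto
      \<comment> \<open>Strictness comes from the \<open>+ 1\<close> in \<open>?a\<close>, or for
        triangular \<open>b\<close> from the sharper \<open>cascade_triangular\<close>.\<close>
      have E1: ?thesis if "0 \<le> d * (3 * c - 4 - 3 * j) + ?e * (3 * c - 13 - 3 * i)"
      proof -
        have "9 * (?e + cap d + cap ?e) \<le> 9 * ?e + 3 * (d * (j - 1)) + 3 * (?e * (i - 1))"
          unfolding distrib_left using cd cce by linarith
        also have "\<dots> \<le> (d + ?e) * (3 * c - 7)" using that by (simp add: algebra_simps)
        finally have f: "9 * (?e + cap d + cap ?e) \<le> b * (3 * c - 7)" by simp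
        have "?e + cap d + cap ?e < ?a"
        proof (cases "c1 = 0")
          case True
          then have "9 * cascade b = 3 * (b * (c - 2))" using cascade_triangular r by simp
          then have "b * (3 * c - 7) < 9 * cascade b" using b0 by (simp add: algebra_simps)
          then show ?thesis using f True by simp
        next
          case False
          then show ?thesis using f cb slack_bounds(1)[of b] unfolding cap_def by simp
        qed
        then show ?thesis unfolding excluded_def by simp
      qed
      show ?thesis
      proof (cases "3 * j \<le> c")
        case True
        \<comment> \<open>As \<open>9 * (j - 1) < 3 * c - 7\<close>, even a link with
          \<open>cap d\<close> lines is too poor for the averaging inequality.\<close>
        have "b * (d * (9 * (j - 1))) < b * (d * (3 * c - 7))"
          using True b0 by (intro mult_strict_left_mono) auto
        also have "\<dots> = d * (b * (3 * c - 7))" by (simp add: ac_simps)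
        also have "\<dots> \<le> d * (9 * ?a)" using cb a b0 by (intro mult_left_mono) linarith+
        finally have "b * (d * (9 * (j - 1))) < d * (9 * ?a)" .
        moreover have "(9 * b) * (3 * cap d) \<le> (9 * b) * (d * (j - 1))" using cd b0 by (intro mult_left_mono) auto
        ultimately have "3 * b * cap d < d * ?a" by (simp add: algebra_simps)
        then show ?thesis unfolding excluded_def by simp
      next
        case j: False
        show ?thesis
        proof (cases "i \<le> c - 3 \<or> 37 \<le> c")
          case True
          show ?thesis by (rule E1, rule crude_inequality[OF r rd re]) (use c d ce j True in auto)
        next
          case False
          then have i: "c - 2 \<le> i" and c36: "c \<le> 36" by auto
          have "(c - 2) * (c - 3) \<le> i * (i - 1)" using tri_mono[OF i] c by simp
          then have d3: "d \<le> 3 * c - 4" using h he by (simp add: algebra_simps)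
          have k: "c div 3 + 1 \<le> j" using j by linarith
          have "(c div 3 + 1) * (c div 3) \<le> j * (j - 1)" using tri_mono[OF k] c by simp
          then have l: "(c div 3 + 1) * (c div 3) div 2 \<le> d" using hd by linarith
          have ck: "check c c1 ((c div 3 + 1) * (c div 3) div 2) (3 * c - 4)"
          proof -
            have "c \<in> set [18..36]" "c1 \<in> set [0..c - 1]"
              unfolding set_upto atLeastAtMost_iff using c c36 h by auto
            then show ?thesis using mid_check unfolding list_all_iff by blast
          qed
          have "18 * (c - 1) \<le> c * (c - 1)" using c by (intro mult_right_mono) auto
          then have n: "3 * c - 4 < b" "3 * c - 4 \<noteq> 0" using h c by (simp_all add: right_diff_distrib)
          have "0 \<le> (c div 3 + 1) * (c div 3) div 2" using c by (simp add: pos_imp_zdiv_nonneg_iff)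
          then show ?thesis using check_sound[OF ck r, of d] l d3 d n H by auto
        qed
      qed
    qed
  qed
qed

text \<open>Away from both special degrees the product in \<open>low_cascade\<close> is at least 1
  and absorbs a slack of 1; where the slack is 2, \<open>slack_rep\<close> makes one factor at least
  3.\<close>

lemma low_degree_step:
  assumes r: "tri_rep b c c1" and d: "1 \<le> d" "d \<le> c - 1" and n: "d \<noteq> c1" "d \<noteq> c - 1"
  shows "2 * cap (b - d) + d * (d - 1) \<le> 2 * cap b" and "c1 = 0 \<Longrightarrow> 2 * cap (b - d) + d * (d - 1) < 2 * cascade b"
proof -
  have h: "1 \<le> c" "0 \<le> c1" "c1 < c" "2 * b = c * (c - 1) + 2 * c1" using r unfolding tri_rep_def by auto
  note sb = slack_bounds(1)[of b] slack_bounds(2)[of "b - d"]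
  have "(2 * cap (b - d) + d * (d - 1) \<le> 2 * cap b) \<and> (c1 = 0 \<longrightarrow> 2 * cap (b - d) + d * (d - 1) < 2 * cascade b)"
  proof (cases "d < c1")
    case True
    have r': "tri_rep (b - d) c (c1 - d)" and q: "2 * cascade (b - d) + d * (d - 1) + 2 * (d * (c1 - d)) = 2 * cascade b"
      using low_cascade(1)[OF r d] True by auto
    have "slack (b - d) \<le> d * (c1 - d)"
    proof (cases "slack (b - d) = 2")
      case True
      then have "3 \<le> c1 - d" using slack_rep(3)[OF r'] by auto
      then have "1 * 3 \<le> d * (c1 - d)" using d by (intro mult_mono) auto
      then show ?thesis using True by simp
    next
      case False
      have "1 * 1 \<le> d * (c1 - d)" using d \<open>d < c1\<close> by (intro mult_mono) auto
      then show ?thesis using False sb by linarith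
    qed
    then show ?thesis using q sb True d unfolding cap_def by auto
  next
    case False
    then have dc: "c1 < d" using n by simp
    have r': "tri_rep (b - d) (c - 1) (c - 1 - d + c1)"
      and q: "2 * cascade (b - d) + d * (d - 1) + 2 * ((c - 1 - d) * (d - c1)) = 2 * cascade b"
      using low_cascade(2)[OF r d dc] by auto
    have m: "1 \<le> c - 1 - d" using d n by simp
    have one: "1 * 1 \<le> (c - 1 - d) * (d - c1)" using m dc by (intro mult_mono) auto
    have "slack (b - d) \<le> (c - 1 - d) * (d - c1)"
    proof (cases "slack (b - d) = 2")
      case True
      then have "4 \<le> d - c1" using slack_rep(3)[OF r'] by auto
      then have "1 * 4 \<le> (c - 1 - d) * (d - c1)" using m by (intro mult_mono) auto
      then show ?thesis using True by simp
    next
      case False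
      then show ?thesis using one sb by linarith
    qed
    moreover have "slack (b - d) < (c - 1 - d) * (d - c1)" if "c1 = 0"
    proof (cases "slack (b - d) = 0")
      case True
      then show ?thesis using one by simp
    next
      case False
      then have "4 \<le> c - 1" using slack_rep(1)[OF r'] by simp
      moreover have "0 \<le> (c - 1 - d - 1) * (d - 1)" using m d by simp
      then have "c - 2 \<le> (c - 1 - d) * d" by (simp add: algebra_simps)
      ultimately show ?thesis using sb that by simp
    qed
    ultimately show ?thesis using q sb unfolding cap_def by auto
  qed
  then show "2 * cap (b - d) + d * (d - 1) \<le> 2 * cap b" "c1 = 0 \<Longrightarrow> 2 * cap (b - d) + d * (d - 1) < 2 * cascade b" by auto
qed

lemma slack_triangular: "tri_rep b c 0 \<Longrightarrow> slack b = 0"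
  using slack_rep(2) by blast

text \<open>For \<open>d = c - 1\<close> the product vanishes and the slack of \<open>b - d\<close>
  is inherited. It exceeds that of \<open>b\<close> by at most one, which is what an incomplete cone
  around \<open>x\<close> saves.\<close>

lemma low_degree_top:
  assumes r: "tri_rep b c c1" and d: "c1 < c - 1"
  shows "2 * cascade (b - (c - 1)) + (c - 1) * (c - 2) = 2 * cascade b"
    and "slack (b - (c - 1)) - 1 \<le> slack b" and "c1 = 0 \<Longrightarrow> slack (b - (c - 1)) = 0"
    and "c1 = 0 \<Longrightarrow> 2 * (b - (c - 1)) = (c - 1) * (c - 2)"
proof -
  have h: "1 \<le> c" "0 \<le> c1" "c1 < c" "2 * b = c * (c - 1) + 2 * c1" using r unfolding tri_rep_def by auto
  have r': "tri_rep (b - (c - 1)) (c - 1) c1" and q: "2 * cascade (b - (c - 1)) + (c - 1) * (c - 1 - 1) = 2 * cascade b"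
    using low_cascade(2)[OF r, of "c - 1"] d h by auto
  show "2 * cascade (b - (c - 1)) + (c - 1) * (c - 2) = 2 * cascade b" using q by simp
  show "slack (b - (c - 1)) - 1 \<le> slack b"
  proof (cases "slack (b - (c - 1)) = 2")
    case True
    \<comment> \<open>These are \<open>24 + 7\<close> and \<open>32 + 8\<close>, both with slack
      1.\<close>
    then have "b = 31 \<or> b = 40" using slack_rep(3)[OF r'] h by auto
    then show ?thesis using True unfolding slack_def by auto
  next
    case False
    then show ?thesis using slack_bounds(1)[of b] slack_bounds(2)[of "b - (c - 1)"] by linarith
  qed
  show "c1 = 0 \<Longrightarrow> slack (b - (c - 1)) = 0" using slack_triangular r' by simp
  show "c1 = 0 \<Longrightarrow> 2 * (b - (c - 1)) = (c - 1) * (c - 2)" using r' unfolding tri_rep_def by simp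
qed

section \<open>The bound on the number of lines\<close>

lemma cascade_nonneg: assumes r: "tri_rep b c c1" shows "0 \<le> cascade b"
proof -
  have h: "1 \<le> c" "0 \<le> c1" using r unfolding tri_rep_def by auto
  have "0 \<le> c * (c - 1) * (c - 2)"
  proof (cases "c = 1")
    case False
    then show ?thesis using h by simp
  qed simp
  moreover have "0 \<le> c1 * (c1 - 1)" using h by (cases "c1 = 0") auto
  ultimately show ?thesis using cascade_eq[OF r] by linarith
qed

lemma cascade_value_split: "2 * cascade_value c c1 = 2 * cascade_value c 0 + c1 * (c1 - 1)"
proof -
  have "3 * (2 * cascade_value c c1) = 3 * (2 * cascade_value c 0 + c1 * (c1 - 1))"
    using cascade_value_eq[of c c1] cascade_value_eq[of c 0] by (simp add: algebra_simps)
  then show ?thesis by simp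
qed

text \<open>The second conjunct, the equality case for triangular \<open>card B\<close>, is applied
  in the induction to links with \<open>C(c,2)\<close> points. The measure includes \<open>q\<close>
  because a link may have as many points as \<open>B\<close>.\<close>

lemma lines_bound:
  fixes B :: "'a set set"
  assumes "uniform q B"
  shows "int (card (lines B)) \<le> cap (int (card B)) \<and>
    (\<forall>c. tri_rep (int (card B)) c 0 \<longrightarrow> cascade (int (card B)) \<le> int (card (lines B)) \<longrightarrow> saturated B)"
  using assms
proof (induction "card B + q" arbitrary: B q rule: less_induct)
  case (less B q)
  note u = less.prems
  define b where "b = int (card B)"
  define a where "a = int (card (lines B))"
  have fB: "finite B" using u unfolding uniform_def by simp
  obtain c c1 where r: "tri_rep b c c1" using tri_rep_exists[of b] unfolding b_def by auto
  have h: "1 \<le> c" "0 \<le> c1" "c1 < c" "2 * b = c * (c - 1) + 2 * c1" using r unfolding tri_rep_def by auto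
  have cb: "cascade b = cascade_value c c1" by (rule cascade_rep[OF r])
  have capb: "cascade b \<le> cap b" using slack_bounds(1)[of b] unfolding cap_def by simp
  have uniq: "c' = c \<and> c1 = 0" if "tri_rep b c' 0" for c' using tri_rep_unique[OF r that] by simp
  have "a \<le> cap b \<and> (c1 = 0 \<longrightarrow> cascade b \<le> a \<longrightarrow> saturated B)"
  proof (cases "\<forall>X. card (spots B X) \<le> 1")
    case True
    have "\<not> 3 \<le> card (spots B X)" "card (spots B X) \<noteq> 2" for X using True[rule_format, of X] by simp_all
    then have "lines B = {}" "saturated B" unfolding lines_def saturated_def by simp_all
    then show ?thesis using cascade_nonneg[OF r] capb unfolding a_def by simp
  next
    case False
    then obtain X0 where X0: "2 \<le> card (spots B X0)" by (metis Suc_1 not_less_eq_eq)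
    then have "spots B X0 \<noteq> {}" by auto
    then have ne: "B \<noteq> {}" unfolding spots_def by auto
    then have "0 < card B" using fB by (simp add: card_gt_0_iff)
    then have b1: "1 \<le> b" unfolding b_def by simp
    have q0: "q \<noteq> 0"
    proof
      assume "q = 0"
      then have "\<Union>B = {}" using u unfolding uniform_def by auto
      then show False using lines_ground[OF X0] \<open>spots B X0 \<noteq> {}\<close> unfolding spots_def by auto
    qed
    have c2: "2 \<le> c" using tri_rep_le_index[OF r, of 2] b1 by simp
    define d where "d x = int (card (link B x))" for x
    define e where "e x = int (card (del B x))" for x
    define t where "t x = int (card (lines (link B x)))" for x
    define w where "w x = int (card (mixed B x))" for x
    define al where "al x = int (card (lines (del B x)))" for x
    have be: "e x = b - d x" for x using card_del_link[OF u, of x] unfolding b_def d_def e_def by simp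
    have d0: "0 \<le> d x" for x unfolding d_def by simp
    have nn: "0 \<le> t x" "0 \<le> w x" "0 \<le> e x" for x unfolding t_def w_def e_def by auto
    have asum: "a = al x + t x + w x" for x
      using card_lines_split[OF u, of x] unfolding a_def al_def t_def w_def by simp
    have we: "w x \<le> e x" for x using card_mixed_le[OF u, of x] unfolding w_def e_def by simp
    have pairs: "6 * t x + 2 * w x \<le> d x * (d x - 1)" for x
    proof (cases "card (link B x)")
      case 0
      then show ?thesis using card_mixed_bound[OF u, of x] unfolding t_def w_def d_def by simp
    next
      case (Suc n)
      have "int (6 * card (lines (link B x)) + 2 * card (mixed B x)) \<le> int (card (link B x) * (card (link B x) - 1))"
        using card_mixed_bound[OF u, of x] by (simp only: of_nat_le_iff)
      then show ?thesis using Suc unfolding t_def w_def d_def by (simp add: algebra_simps)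
    qed
    have IHl: "t x \<le> cap (d x)" "tri_rep (d x) c' 0 \<Longrightarrow> cascade (d x) \<le> t x \<Longrightarrow> saturated (link B x)" for x c'
    proof -
      have "card (link B x) \<le> card B" using card_del_link[OF u, of x] by simp
      then have "card (link B x) + (q - 1) < card B + q" using q0 by simp
      from less.hyps[OF this uniform_link[OF u]]
      show "t x \<le> cap (d x)" "tri_rep (d x) c' 0 \<Longrightarrow> cascade (d x) \<le> t x \<Longrightarrow> saturated (link B x)"
        unfolding t_def d_def by auto
    qed
    have IHs: "int (card (lines M)) \<le> cap (int (card M))" if "M \<subseteq> B" "card M < card B" for M
      using less.hyps[of M q] uniform_subset[OF u that(1)] that(2) by simp
    have IHd: "al x \<le> cap (b - d x)" if "0 < d x" for x
    proof -
      have "card (del B x) < card B" using card_del_link[OF u, of x] that unfolding d_def by simp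
      then have "int (card (lines (del B x))) \<le> cap (int (card (del B x)))"
        by (intro IHs) (auto simp: del_def)
      then show ?thesis using be[of x] unfolding al_def e_def by simp
    qed
    \<comment> \<open>\<open>M\<close> has at most \<open>C(c,3)\<close> lines, and the
      \<open>c1\<close> remaining points add at most \<open>C(c1,2)\<close>, so no excess
      survives.\<close>
    have extension: "2 * a \<le> 2 * cascade b" if M: "M \<subseteq> B" "saturated M" "2 * int (card M) = c * (c - 1)" and "c1 \<noteq> 0" for M
    proof -
      have cM: "int (card M) = b - c1" using M(3) h(4) by simp
      then have "card M < card B" using h(2) \<open>c1 \<noteq> 0\<close> unfolding b_def by simp
      then have l: "int (card (lines M)) \<le> cap (int (card M))" by (rule IHs[OF M(1)])
      have rM: "tri_rep (int (card M)) c 0" using M(3) h unfolding tri_rep_def by simp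
      have "card (B - M) = card B - card M" using M(1) fB by (simp add: card_Diff_subset finite_subset)
      then have BM: "int (card (B - M)) = c1" using cM \<open>card M < card B\<close> unfolding b_def by simp
      have "int (2 * card (lines B)) \<le> int (2 * card (lines M) + card (B - M) * (card (B - M) - 1))"
        using card_lines_saturated_part[OF u M(1,2)] by (simp only: of_nat_le_iff)
      moreover have "int (card (B - M) * (card (B - M) - 1)) = c1 * (c1 - 1)"
        using BM h(2) \<open>c1 \<noteq> 0\<close> by (simp add: of_nat_diff)
      moreover have "cap (int (card M)) = cascade_value c 0"
        using cascade_rep[OF rM] slack_triangular[OF rM] unfolding cap_def by simp
      ultimately have "2 * a \<le> 2 * cascade_value c 0 + c1 * (c1 - 1)" using l unfolding a_def by simp
      then show ?thesis using cascade_value_split[of c c1] cb by simp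
    qed
    consider (full) x where "d x = b" | (low) x where "1 \<le> d x" "d x \<le> c - 1" "d x < b"
      | (high) "\<And>x. 1 \<le> d x \<Longrightarrow> c \<le> d x \<and> d x < b"
    proof -
      have db: "d x \<le> b" for x using be[of x] nn(3)[of x] by simp
      show ?thesis
      proof (cases "\<exists>x. d x = b \<or> 1 \<le> d x \<and> d x \<le> c - 1")
        case True
        then obtain x where "d x = b \<or> 1 \<le> d x \<and> d x \<le> c - 1" by blast
        then show ?thesis using full[of x] low[of x] db[of x] by linarith
      next
        case False
        then have "c \<le> d x \<and> d x < b" if "1 \<le> d x" for x
          using that db[of x] by (metis le_less not_le zle_diff1_eq)
        then show ?thesis by (rule high)
      qed
    qed
    then show ?thesis
    proof cases
      case full
      have "e x = 0" using full be by simp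
      then have del: "del B x = {}" using uniform_del[OF u, of x] unfolding e_def uniform_def by simp
      then have "mixed B x = {}" "lines (del B x) = {}" unfolding mixed_def lines_def spots_def by auto
      then have at: "a = t x" using asum[of x] unfolding w_def al_def by simp
      have "{Y\<in>B. x \<in> Y} = B" using del unfolding del_def by auto
      then show ?thesis using IHl(1)[of x] IHl(2)[of x c] saturated_insert_image[OF u, of x] full at r by auto
    next
      case low
      define D where "D = d x"
      have D: "1 \<le> D" "D \<le> c - 1" using low unfolding D_def by auto
      have alD: "al x \<le> cap (b - D)" using IHd low unfolding D_def by simp
      have p: "2 * t x + 2 * w x \<le> D * (D - 1) - 4 * t x" using pairs[of x] unfolding D_def by simp
      have bound: "2 * a \<le> 2 * cap (b - D) + D * (D - 1)" using asum[of x] alD p nn(1)[of x] by linarith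
      consider "D \<noteq> c1" "D \<noteq> c - 1" | "D = c1" | "D = c - 1" "c1 < c - 1" using h by linarith
      then show ?thesis
      proof cases
        case 1
        then show ?thesis using low_degree_step[OF r D] bound by fastforce
      next
        case 2
        have "tri_rep (b - D) c 0" "2 * cascade (b - D) + D * (D - 1) = 2 * cascade b"
          using low_cascade(1)[OF r D] 2 by auto
        then show ?thesis using bound slack_triangular capb D 2 unfolding cap_def by auto
      next
        case 3
        note top = low_degree_top[OF r 3(2), folded 3(1)]
        have Dc: "D * (D - 1) = D * (c - 2)" using 3 by simp
        show ?thesis
        proof (cases "t x = 0 \<and> 2 * w x = D * (D - 1)")
          case True
          \<comment> \<open>Equality in the pair count: the \<open>D\<close> points through
            \<open>x\<close> and the \<open>C(D,2)\<close> mixed sets form a saturated family of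
            \<open>C(c,2)\<close> points.\<close>
          define M where "M = {Y\<in>B. x \<in> Y} \<union> mixed B x"
          have "lines (link B x) = {}"
            using True finite_lines[OF uniform_link[OF u, of x]] unfolding t_def by simp
          moreover have "2 * card (mixed B x) = card (link B x) * (card (link B x) - 1)"
          proof -
            have "1 \<le> card (link B x)" using D unfolding D_def d_def by simp
            then have "int (2 * card (mixed B x)) = int (card (link B x) * (card (link B x) - 1))"
              using True unfolding w_def D_def d_def by (simp add: of_nat_diff)
            then show ?thesis by (simp only: of_nat_eq_iff)
          qed
          ultimately have sat: "saturated M" unfolding M_def by (rule saturated_cone[OF u])
          have MB: "M \<subseteq> B" unfolding M_def mixed_def del_def by auto
          have "card M = card {Y\<in>B. x \<in> Y} + card (mixed B x)" unfolding M_def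
            by (rule card_Un_disjoint) (use fB in \<open>auto simp: mixed_def del_def\<close>)
          then have "int (card M) = D + w x" unfolding card_link[symmetric] D_def d_def w_def by simp
          then have cM: "2 * int (card M) = c * (c - 1)" using True 3 by (simp add: algebra_simps)
          show ?thesis
          proof (cases "c1 = 0")
            case True
            then have "card M = card B" using cM h(4) unfolding b_def by simp
            then have "M = B" using MB fB card_subset_eq by blast
            then have "saturated B" using sat by simp
            moreover have "2 * a \<le> 2 * cascade b" using bound top(1) top(3)[OF True] Dc unfolding cap_def by simp
            ultimately show ?thesis using capb by simp
          next
            case False
            then have "2 * a \<le> 2 * cascade b" by (rule extension[OF MB sat cM])
            then show ?thesis using capb False by simp
          qed
        next
          case False
          \<comment> \<open>At least one is lost: by parity if \<open>t x = 0\<close>, otherwise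
            because lines of the link cost extra pairs. This pays for a slack that drops by
            one.\<close>
          have "2 * t x + 2 * w x \<le> D * (D - 1) - 2"
          proof (cases "t x = 0")
            case True
            then have "2 * w x < D * (D - 1)" using False p by simp
            moreover obtain k where "D * (D - 1) = 2 * k" using tri_even[of D] by (rule dvdE)
            ultimately show ?thesis using True by simp
          next
            case False
            then show ?thesis using p nn(1)[of x] by linarith
          qed
          then have "2 * a \<le> 2 * cap (b - D) + D * (D - 1) - 2" using asum[of x] alD by linarith
          then have "2 * a \<le> 2 * cascade b + 2 * slack (b - D) - 2" using top(1) Dc unfolding cap_def by simp
          then show ?thesis using top(2,3) unfolding cap_def by auto
        qed
      qed
    next
      case high
      have fV: "finite (\<Union>B)" using u unfolding uniform_def by auto
      have dpos: "1 \<le> d x" if "x \<in> \<Union>B" for x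
      proof -
        have "{Y\<in>B. x \<in> Y} \<noteq> {}" using that by auto
        then have "0 < card {Y\<in>B. x \<in> Y}" using fB by (simp add: card_gt_0_iff)
        then show ?thesis unfolding d_def card_link by simp
      qed
      obtain Y where Y: "Y \<in> B" using ne by auto
      then have Yq: "card Y = q" "finite Y" using u unfolding uniform_def by auto
      then obtain y where y: "y \<in> Y" using q0 by fastforce
      then have yV: "y \<in> \<Union>B" using Y by auto
      have "q \<noteq> 1"
      proof
        assume "q = 1"
        then have "Z = {y}" if "Z \<in> B" "y \<in> Z" for Z
          using that u unfolding uniform_def by (metis card_1_singletonE singletonD)
        then have "{Z\<in>B. y \<in> Z} \<subseteq> {{y}}" by auto
        then have "card {Z\<in>B. y \<in> Z} \<le> 1" using card_mono[of "{{y}}" "{Z\<in>B. y \<in> Z}"] by simp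
        then have "d y \<le> 1" unfolding d_def card_link by simp
        then show False using high[OF dpos[OF yV]] c2 by simp
      qed
      moreover have "q \<noteq> 2"
      proof
        assume q2: "q = 2"
        \<comment> \<open>A graph of minimum degree at least \<open>c\<close> has at least
          \<open>c + 1\<close> vertices, hence at least \<open>C(c + 1, 2) > b\<close>
          edges.\<close>
        define n where "n = int (card (\<Union>B))"
        have "d x \<le> n - 1" if "x \<in> \<Union>B" for x
        proof -
          have "link B x \<subseteq> (\<lambda>z. {z}) ` (\<Union>B - {x})"
          proof
            fix Z assume Z: "Z \<in> link B x"
            then have "card Z = 1" using uniform_link[OF u, of x] q2 unfolding uniform_def by simp
            then obtain z where "Z = {z}" by (rule card_1_singletonE)
            moreover have "insert x Z \<in> B" "x \<notin> Z" using Z unfolding link_def by auto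
            ultimately show "Z \<in> (\<lambda>z. {z}) ` (\<Union>B - {x})" by blast
          qed
          then have "card (link B x) \<le> card (\<Union>B - {x})" using fV by (meson finite_Diff surj_card_le)
          moreover have "Suc (card (\<Union>B - {x})) = card (\<Union>B)" using card_Suc_Diff1[OF fV that] .
          ultimately show ?thesis unfolding d_def n_def by simp
        qed
        then have cn: "c + 1 \<le> n" using high[OF dpos[OF yV]] yV by force
        have "(\<Sum>x\<in>\<Union>B. c) \<le> (\<Sum>x\<in>\<Union>B. d x)" using high dpos by (intro sum_mono) blast
        also have "\<dots> = 2 * b" using sum_card_link[OF u] q2 unfolding d_def b_def by (metis of_nat_mult of_nat_numeral of_nat_sum)
        finally have "n * c \<le> 2 * b" unfolding n_def by simp
        moreover have "(c + 1) * c \<le> n * c" using cn h by (intro mult_right_mono) auto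
        ultimately show False using h by (simp add: algebra_simps)
      qed
      ultimately have q3: "3 \<le> q" using q0 by simp
      obtain x where x: "0 < card (link B x)" "card (lines B) * card (link B x) \<le> 3 * card B * card (lines (link B x))"
        using exists_rich_link[OF u q3 ne] by blast
      have dx: "c \<le> d x" "d x < b" "0 < d x" using high[of x] x(1) unfolding d_def by auto
      have "int (card (lines B) * card (link B x)) \<le> int (3 * card B * card (lines (link B x)))"
        using x(2) by (simp only: of_nat_le_iff)
      then have rich: "d x * a \<le> 3 * b * t x" unfolding a_def b_def d_def t_def by (simp add: mult.commute)
      have alx: "al x \<le> cap (b - d x)" by (rule IHd[OF dx(3)])
      show ?thesis
      proof (cases "b - d x = c1 \<and> c1 \<le> 3")
        case True
        then have rd: "tri_rep (d x) c 0" and c1p: "1 \<le> c1" using h dx unfolding tri_rep_def by auto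
        have cd: "cap (d x) = cascade_value c 0" "cascade (d x) = cascade_value c 0"
          using cascade_rep[OF rd] slack_triangular[OF rd] unfolding cap_def by auto
        have "2 * a \<le> 2 * cascade b"
        proof (cases "cascade_value c 0 \<le> t x")
          case t: True
          define M where "M = {Y\<in>B. x \<in> Y}"
          have "saturated (link B x)" using IHl(2)[OF rd] t cd by simp
          then have "saturated M" unfolding M_def by (rule saturated_insert_image[OF u])
          moreover have "M \<subseteq> B" unfolding M_def by auto
          moreover have "2 * int (card M) = c * (c - 1)"
            using rd unfolding M_def card_link[symmetric] d_def tri_rep_def by simp
          ultimately show ?thesis using extension c1p by simp
        next
          case False
          have "tri_rep 1 2 0" "tri_rep 2 2 1" "tri_rep 3 3 0" unfolding tri_rep_def by auto
          then have cs: "cascade 1 = 0" "cascade 2 = 0" "cascade 3 = 1" using cascade_eq by force+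
          have "c1 = 1 \<or> c1 = 2 \<or> c1 = 3" using c1p True by linarith
          \<comment> \<open>Tight for 1, 2 and 3: the one line missing from the link just pays for
            the mixed sets and the lines of the deletion.\<close>
          then have "2 * cap c1 + 2 * c1 - 2 \<le> c1 * (c1 - 1)" using cs unfolding cap_def slack_def by auto
          moreover have "a \<le> cap c1 + (cascade_value c 0 - 1) + c1"
            using asum[of x] alx we[of x] be[of x] True False by simp
          ultimately show ?thesis using cascade_value_split[of c c1] cb by linarith
        qed
        then show ?thesis using capb c1p by simp
      next
        case False
        have "a < (if c1 = 0 then cascade b else cap b + 1)"
        proof (rule excluded_sound[OF high_excluded[OF r dx(1,2) False]])
          show "0 < b" "0 < d x" using dx b1 by auto
          show "t x \<le> cap (d x)" by (rule IHl(1))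
          show "w x \<le> b - d x" using we[of x] be[of x] by simp
          show "a \<le> cap (b - d x) + t x + w x" using asum[of x] alx by simp
          show "d x * a \<le> 3 * b * t x" by (rule rich)
          show "0 \<le> t x" by (rule nn)
          fix m :: int assume m: "0 \<le> m"
          have "finite (mixed B x)" "\<And>W. W \<in> mixed B x \<Longrightarrow> card (spots (link B x) W) = 2"
            using fB unfolding mixed_def del_def by auto
          note ineq = lines_rich_inequality[OF uniform_link[OF u] this]
          obtain k n where k: "m = int k" and n: "card (link B x) = Suc n"
            using m x(1) by (metis nonneg_int_cases gr0_implies_Suc)
          have "int ((12 + 6 * k) * card (lines (link B x)) + 4 * card (mixed B x))
            \<le> int (2 * (Suc n * n) + Suc n * (k * (k + 1)))"
            using ineq[of k] unfolding n by (simp only: of_nat_le_iff diff_Suc_1)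
          then show "(12 + 6 * m) * t x + 4 * w x \<le> 2 * d x * (d x - 1) + d x * (m * (m + 1))"
            unfolding t_def w_def d_def n k by (simp add: algebra_simps)
        qed
        then show ?thesis using capb by (auto split: if_splits)
      qed
    qed
  qed
  then show ?case using uniq unfolding a_def b_def by blast
qed

section \<open>Extremal numbers\<close>

lemma admissible_uniform:
  assumes "admissible (Suc q) k A B"
  shows "uniform q B" "finite A" "\<And>X. X \<in> A \<Longrightarrow> k \<le> card (spots B X)"
proof -
  show u: "uniform q B" and "finite A"
    using assms unfolding admissible_def layer_def uniform_def by auto
  fix X assume "X \<in> A"
  then have "finite X" "card X = Suc q" "k \<le> card {Y\<in>B. Y \<subseteq> X}"
    using assms unfolding admissible_def layer_def by auto
  then show "k \<le> card (spots B X)" using card_points[OF u] by simp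
qed

text \<open>A construction with sets of size \<open>k\<close> is lifted to size \<open>r\<close> by
  adding a common core of \<open>r - k\<close> new elements to all sets.\<close>

lemma admissible_join:
  fixes T E :: "nat set set"
  assumes T: "finite T" "\<And>X. X \<in> T \<Longrightarrow> X \<subseteq> {..<N} \<and> card X = k"
    and E: "finite E" "\<And>Y. Y \<in> E \<Longrightarrow> Y \<subseteq> {..<N} \<and> card Y = k - 1"
    and TE: "\<And>X x. X \<in> T \<Longrightarrow> x \<in> X \<Longrightarrow> X - {x} \<in> E" and k: "1 \<le> k" "k \<le> r"
  shows "\<exists>A B. admissible r k A B \<and> card A = card T \<and> card B = card E"
proof -
  define F where "F = {N..<N + (r - k)}"
  define g where "g X = X \<union> F" for X
  have F: "finite F" "card F = r - k" unfolding F_def by auto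
  have disj: "X \<inter> F = {}" if "X \<subseteq> {..<N}" for X using that unfolding F_def by auto
  have inj: "X = Y" if "g X = g Y" "X \<subseteq> {..<N}" "Y \<subseteq> {..<N}" for X Y
  proof -
    have "X = g X - F" "Y = g Y - F" using disj[OF that(2)] disj[OF that(3)] unfolding g_def by auto
    then show ?thesis using that(1) by simp
  qed
  have cg: "finite (g X)" "card (g X) = card X + (r - k)" if "X \<subseteq> {..<N}" for X
  proof -
    have "finite X" using that finite_subset by blast
    then show "finite (g X)" "card (g X) = card X + (r - k)"
      using F disj[OF that] unfolding g_def by (auto simp: card_Un_disjoint)
  qed
  have iT: "inj_on g T" by (rule inj_onI, rule inj) (use T(2) in auto)
  have iE: "inj_on g E" by (rule inj_onI, rule inj) (use E(2) in auto)
  have "admissible r k (g ` T) (g ` E)"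
    unfolding admissible_def
  proof (intro conjI ballI)
    show "g ` T \<subseteq> layer (int r)"
    proof
      fix Z assume "Z \<in> g ` T"
      then obtain X where X: "X \<in> T" "Z = g X" by auto
      then have "finite Z" "card Z = k + (r - k)" using T(2)[OF X(1)] cg[of X] by auto
      then show "Z \<in> layer (int r)" using k unfolding layer_def by simp
    qed
    show "g ` E \<subseteq> layer (int r - 1)"
    proof
      fix Z assume "Z \<in> g ` E"
      then obtain Y where Y: "Y \<in> E" "Z = g Y" by auto
      then have "finite Z" "card Z = (k - 1) + (r - k)" using E(2)[OF Y(1)] cg[of Y] by auto
      then show "Z \<in> layer (int r - 1)" using k unfolding layer_def by simp
    qed
    show "finite (g ` T)" "finite (g ` E)" using T E by auto
    fix Z assume "Z \<in> g ` T"
    then obtain X where X: "X \<in> T" "Z = g X" by auto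
    have XN: "X \<subseteq> {..<N}" "card X = k" using T(2)[OF X(1)] by auto
    have "inj_on (\<lambda>x. g (X - {x})) X"
    proof (rule inj_onI)
      fix x y assume xy: "x \<in> X" "y \<in> X" "g (X - {x}) = g (X - {y})"
      have "X - {x} = X - {y}" by (rule inj[OF xy(3)]) (use XN in auto)
      then show "x = y" using xy by blast
    qed
    then have "k = card ((\<lambda>x. g (X - {x})) ` X)" using XN by (simp add: card_image)
    also have "\<dots> \<le> card {Y\<in>g ` E. Y \<subseteq> Z}"
    proof (rule card_mono)
      show "finite {Y\<in>g ` E. Y \<subseteq> Z}" using E by auto
      show "(\<lambda>x. g (X - {x})) ` X \<subseteq> {Y\<in>g ` E. Y \<subseteq> Z}"
      proof clarify
        fix x assume "x \<in> X"
        then have "g (X - {x}) \<in> g ` E" using TE[OF X(1)] by blast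
        moreover have "g (X - {x}) \<subseteq> Z" unfolding X(2) g_def by auto
        ultimately show "g (X - {x}) \<in> g ` E \<and> g (X - {x}) \<subseteq> Z" by simp
      qed
    qed
    finally show "k \<le> card {Y\<in>g ` E. Y \<subseteq> Z}" .
  qed
  then show ?thesis using card_image[OF iT] card_image[OF iE] by blast
qed

lemma int_choose2: "2 * int (n choose 2) = int n * (int n - 1)"
proof (cases n)
  case (Suc m)
  have "even (n * (n - 1))" using Suc by simp
  then have "2 * (n choose 2) = n * (n - 1)" unfolding choose_two by simp
  then have "int (2 * (n choose 2)) = int (n * (n - 1))" by (simp only:)
  then show ?thesis using Suc by (simp add: algebra_simps)
qed simp

lemma int_choose3: "6 * int (n choose 3) = int n * (int n - 1) * (int n - 2)"
proof (induction n)
  case (Suc n)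
  have "Suc n choose 3 = (n choose 2) + (n choose 3)" by (simp add: numeral_3_eq_3 numeral_2_eq_2)
  then have "6 * int (Suc n choose 3) = 3 * (2 * int (n choose 2)) + 6 * int (n choose 3)" by simp
  then show ?case unfolding int_choose2 Suc by (simp add: algebra_simps)
qed simp

section \<open>The values of \<open>f\<close> for \<open>k = 2\<close> and
  \<open>k = 3\<close>\<close>

lemma f_two: assumes "2 \<le> r" shows "f r 2 b = b choose 2"
  unfolding f_def
proof (rule Greatest_equality)
  let ?T = "{X. X \<subseteq> {..<b} \<and> card X = 2}"
  let ?E = "(\<lambda>i. {i}) ` {..<b}"
  have "\<exists>A B. admissible r 2 A B \<and> card A = card ?T \<and> card B = card ?E"
  proof (rule admissible_join[where N = b])
    fix X x assume h: "X \<in> ?T" "x \<in> X"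
    then have "card (X - {x}) = 1" by (simp add: finite_subset)
    then obtain i where "X - {x} = {i}" by (rule card_1_singletonE)
    moreover have "i < b" using h calculation by auto
    ultimately show "X - {x} \<in> ?E" by auto
  qed (use assms in auto)
  moreover have "card ?T = b choose 2" using n_subsets[of "{..<b}" 2] by simp
  moreover have "card ?E = b" by (simp add: card_image)
  ultimately show "\<exists>A B. admissible r 2 A B \<and> card A = b choose 2 \<and> card B = b" by simp
next
  fix a assume "\<exists>A B. admissible r 2 A B \<and> card A = a \<and> card B = b"
  then obtain A B where AB: "admissible r 2 A B" "card A = a" "card B = b" by blast
  obtain q where q: "r = Suc q" using assms by (cases r) auto
  note ad = admissible_uniform[OF AB(1)[unfolded q]]
  have "2 * a \<le> b * (b - 1)" using card_rich_le[OF ad(1,2)] ad(3) AB by auto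
  then show "a \<le> b choose 2" unfolding choose_two by simp
qed

lemma f_three:
  assumes r: "3 \<le> r" and c: "c1 < c2" "29 \<le> c2"
  shows "f r 3 ((c2 choose 2) + (c1 choose 1)) = (c2 choose 3) + (c1 choose 2)"
  unfolding f_def
proof (rule Greatest_equality)
  \<comment> \<open>The graph is complete on \<open>c2\<close> vertices, with one more vertex joined
    to \<open>c1\<close> of them; the larger sets are its triangles.\<close>
  let ?E1 = "{Y. Y \<subseteq> {..<c2} \<and> card Y = 2}" and ?E2 = "(\<lambda>i. {i, c2}) ` {..<c1}"
  let ?T1 = "{X. X \<subseteq> {..<c2} \<and> card X = 3}" and ?T2 = "insert c2 ` {P. P \<subseteq> {..<c1} \<and> card P = 2}"
  have "\<exists>A B. admissible r 3 A B \<and> card A = card (?T1 \<union> ?T2) \<and> card B = card (?E1 \<union> ?E2)"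
  proof (rule admissible_join[where N = "Suc c2"])
    show "finite (?T1 \<union> ?T2)" "finite (?E1 \<union> ?E2)" by auto
    show "X \<subseteq> {..<Suc c2} \<and> card X = 3" if "X \<in> ?T1 \<union> ?T2" for X
      using that
    proof
      assume "X \<in> ?T2"
      then obtain P where P: "P \<subseteq> {..<c1}" "card P = 2" "X = insert c2 P" by auto
      moreover have "finite P" "c2 \<notin> P" using P(1) c finite_subset by auto
      ultimately show ?thesis using c by auto
    qed auto
    show "Y \<subseteq> {..<Suc c2} \<and> card Y = 3 - 1" if "Y \<in> ?E1 \<union> ?E2" for Y
      using that c by auto
    show "X - {x} \<in> ?E1 \<union> ?E2" if X: "X \<in> ?T1 \<union> ?T2" "x \<in> X" for X x
      using X(1)
    proof
      assume "X \<in> ?T1"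
      then show ?thesis using X(2) by (auto simp: finite_subset)
    next
      assume "X \<in> ?T2"
      then obtain P where P: "P \<subseteq> {..<c1}" "card P = 2" "X = insert c2 P" by auto
      have fP: "finite P" "c2 \<notin> P" using P(1) c finite_subset by auto
      show ?thesis
      proof (cases "x = c2")
        case True
        then have "X - {x} = P" using P(3) fP by auto
        moreover have "P \<subseteq> {..<c2}" using P(1) c by auto
        ultimately show ?thesis using P(2) by simp
      next
        case False
        then have "x \<in> P" using P X by auto
        then have "card (P - {x}) = 1" using P fP by simp
        then obtain i where i: "P - {x} = {i}" by (rule card_1_singletonE)
        then have "i < c1" using P by auto
        moreover have "X - {x} = {i, c2}" using i P(3) False by auto
        ultimately show ?thesis by blast
      qed
    qed
  qed (use r in auto)
  moreover have "card (?T1 \<union> ?T2) = (c2 choose 3) + (c1 choose 2)"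
  proof -
    have "inj_on (insert c2) {P. P \<subseteq> {..<c1} \<and> card P = 2}"
    proof (rule inj_onI)
      fix P Q assume h: "P \<in> {P. P \<subseteq> {..<c1} \<and> card P = 2}" "Q \<in> {P. P \<subseteq> {..<c1} \<and> card P = 2}"
        "insert c2 P = insert c2 Q"
      then have "c2 \<notin> P" "c2 \<notin> Q" using c by auto
      then show "P = Q" using h(3) by (simp add: insert_ident)
    qed
    then have "card ?T2 = c1 choose 2" using n_subsets[of "{..<c1}" 2] by (simp add: card_image)
    moreover have "card ?T1 = c2 choose 3" using n_subsets[of "{..<c2}" 3] by simp
    moreover have "card (?T1 \<union> ?T2) = card ?T1 + card ?T2" by (rule card_Un_disjoint) auto
    ultimately show ?thesis by simp
  qed
  moreover have "card (?E1 \<union> ?E2) = (c2 choose 2) + (c1 choose 1)"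
  proof -
    have "inj_on (\<lambda>i. {i, c2}) {..<c1}" using c by (auto simp: inj_on_def doubleton_eq_iff)
    then have "card ?E2 = c1" by (simp add: card_image)
    moreover have "card ?E1 = c2 choose 2" using n_subsets[of "{..<c2}" 2] by simp
    moreover have "card (?E1 \<union> ?E2) = card ?E1 + card ?E2" by (rule card_Un_disjoint) auto
    ultimately show ?thesis by simp
  qed
  ultimately show "\<exists>A B. admissible r 3 A B \<and> card A = (c2 choose 3) + (c1 choose 2) \<and> card B = (c2 choose 2) + (c1 choose 1)"
    by simp
next
  fix a assume "\<exists>A B. admissible r 3 A B \<and> card A = a \<and> card B = (c2 choose 2) + (c1 choose 1)"
  then obtain A B where AB: "admissible r 3 A B" "card A = a" "card B = (c2 choose 2) + c1" by auto
  obtain q where q: "r = Suc q" using r by (cases r) auto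
  note ad = admissible_uniform[OF AB(1)[unfolded q]]
  have "A \<subseteq> lines B" using ad(3) unfolding lines_def by auto
  then have "a \<le> card (lines B)" using AB(2) card_mono[OF finite_lines[OF ad(1)]] by blast
  then have le: "int a \<le> cap (int (card B))" using lines_bound[OF ad(1)] by linarith
  have rp: "tri_rep (int (card B)) (int c2) (int c1)"
    using c int_choose2[of c2] unfolding AB(3) tri_rep_def by auto
  \<comment> \<open>So \<open>b\<close> is at least 406, beyond the last exceptional value
    61.\<close>
  have "29 * 28 \<le> int c2 * (int c2 - 1)" using c by (intro mult_mono) auto
  then have "61 < int (card B)" using rp unfolding tri_rep_def by linarith
  then have "6 * cap (int (card B)) = 6 * int (c2 choose 3) + 3 * (2 * int (c1 choose 2))"
    using cascade_eq[OF rp] slack_bounds(3) unfolding cap_def int_choose2 int_choose3 by simp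
  then have "int a \<le> int ((c2 choose 3) + (c1 choose 2))" using le by simp
  then show "a \<le> (c2 choose 3) + (c1 choose 2)" by (simp only: of_nat_le_iff)
qed

section \<open>The least \<open>b\<close> for \<open>k = 0\<close> and \<open>k = 1\<close>\<close>

lemma min_b_zero: assumes "admissible r 0 A B" shows "min_b r 0 (card A) = 0"
proof -
  \<comment> \<open>\<open>A\<close> has to be given, since for \<open>r = 0\<close> only
    \<open>a \<le> 1\<close> can occur.\<close>
  have "admissible r 0 A {}" using assms unfolding admissible_def by simp
  then have "(LEAST b. \<exists>A' B. admissible r 0 A' B \<and> card A' = card A \<and> card B = b) = 0"
    by (intro Least_equality exI[of _ A] exI[of _ "{}"]) auto
  then show ?thesis unfolding min_b_def .
qed

lemma min_b_one: assumes "1 \<le> r" shows "min_b r 1 a = (if a \<ge> 1 then 1 else 0)"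
proof (cases "a = 0")
  case True
  have "admissible r 1 {} {}" unfolding admissible_def by simp
  then have "(LEAST b. \<exists>A B. admissible r 1 A B \<and> card A = a \<and> card B = b) = 0"
    using True by (intro Least_equality) (auto intro!: exI[of _ "{}"])
  then show ?thesis using True unfolding min_b_def by simp
next
  case False
  \<comment> \<open>A sunflower: \<open>a\<close> sets of size \<open>r\<close> around a core of
    \<open>r - 1\<close> elements, which is the only member of the second family.\<close>
  define F where "F = {..<r - 1}"
  define A where "A = (\<lambda>i. insert (r + i) F) ` {..<a}"
  have "inj_on (\<lambda>i. insert (r + i) F) {..<a}"
  proof (rule inj_onI)
    fix i j assume "insert (r + i) F = insert (r + j) F"
    then have "r + i \<in> insert (r + j) F" by blast
    then show "i = j" unfolding F_def by auto
  qed
  then have cA: "card A = a" unfolding A_def by (simp add: card_image)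
  have "{Y\<in>{F}. Y \<subseteq> X} = {F}" if "X \<in> A" for X using that unfolding A_def by auto
  then have "admissible r 1 A {F}"
    using assms unfolding admissible_def layer_def A_def F_def by auto
  then have "(LEAST b. \<exists>A B. admissible r 1 A B \<and> card A = a \<and> card B = b) = 1"
  proof (intro Least_equality)
    show "\<exists>A B. admissible r 1 A B \<and> card A = a \<and> card B = 1" if "admissible r 1 A {F}"
      using that cA by (intro exI[of _ A] exI[of _ "{F}"]) simp
    fix b assume "\<exists>A B. admissible r 1 A B \<and> card A = a \<and> card B = b"
    then obtain A' B where AB: "admissible r 1 A' B" "card A' = a" "card B = b" by blast
    then obtain X where "X \<in> A'" using False by fastforce
    then have "1 \<le> card {Y\<in>B. Y \<subseteq> X}" "finite B" using AB(1) unfolding admissible_def by auto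
    then have "B \<noteq> {}" by auto
    then have "0 < card B" using \<open>finite B\<close> by (simp add: card_gt_0_iff)
    then show "1 \<le> b" using AB(3) by simp
  qed
  then show ?thesis using False unfolding min_b_def by simp
qed

theorem theorem1:
  fixes r k :: nat
  assumes "k \<le> r"
  shows "(k = 0 \<longrightarrow> (\<forall>a. (\<exists>A B. admissible r k A B \<and> card A = a) \<longrightarrow> min_b r k a = 0))
       \<and> (k = 1 \<longrightarrow> (\<forall>a. min_b r k a = (if a \<ge> 1 then 1 else 0)))
       \<and> (k = 2 \<longrightarrow> (\<forall>b. f r 2 b = b choose 2))
       \<and> (k = 3 \<longrightarrow> (\<forall>c1 c2. c2 > c1 \<and> c2 \<ge> 29 \<longrightarrow>
              f r 3 ((c2 choose 2) + (c1 choose 1)) = (c2 choose 3) + (c1 choose 2)))"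
proof (intro conjI impI allI)
  fix a assume "k = 0" "\<exists>A B. admissible r k A B \<and> card A = a"
  then show "min_b r k a = 0" using min_b_zero by auto
next
  fix a assume "k = 1"
  then show "min_b r k a = (if a \<ge> 1 then 1 else 0)" using min_b_one assms by simp
next
  fix b assume "k = 2"
  then show "f r 2 b = b choose 2" using f_two assms by simp
next
  fix c1 c2 :: nat assume "k = 3" "c2 > c1 \<and> c2 \<ge> 29"
  then show "f r 3 ((c2 choose 2) + (c1 choose 1)) = (c2 choose 3) + (c1 choose 2)"
    using f_three assms by simp
qed

end
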